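(* There is a finitely generated amenable group that is not elementary amenable.
   Context: Groups are discrete. The class of elementary amenable groups is the smallest class of countable groups that contains all finite groups and all (countable) abelian groups and is closed under group extensions, countable increasing unions, taking subgroups, and taking quotients. *)

theory Defs
  imports "HOL-Algebra.Algebra"
begin

definition finitely_generated_group :: "('a, 'b) monoid_scheme \<Rightarrow> bool" where
  "finitely_generated_group G \<longleftrightarrow>
     group G \<and> (\<exists>S. finite S \<and> S \<subseteq> carrier G \<and> generate G S = carrier G)"

text \<open>
  Amenability of a discrete group, in the sense of von Neumann: there is a left-invariant,
  finitely additive probability measure defined on all subsets of the group.
\<close>

definition amenable_group :: "('a, 'b) monoid_scheme \<Rightarrow> bool" where
  "amenable_group G \<longleftrightarrow> group G \<and>
     (\<exists>\<mu> :: 'a set \<Rightarrow> real.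
        (\<forall>A. A \<subseteq> carrier G \<longrightarrow> 0 \<le> \<mu> A) \<and>
        \<mu> (carrier G) = 1 \<and>
        (\<forall>A B. A \<subseteq> carrier G \<longrightarrow> B \<subseteq> carrier G \<longrightarrow> A \<inter> B = {} \<longrightarrow>
           \<mu> (A \<union> B) = \<mu> A + \<mu> B) \<and>
        (\<forall>g A. g \<in> carrier G \<longrightarrow> A \<subseteq> carrier G \<longrightarrow> \<mu> (g <#\<^bsub>G\<^esub> A) = \<mu> A))"

text \<open>
  The class of elementary amenable groups is defined first on groups whose carrier is a set of
  natural numbers. Every countable group is isomorphic to such a group, and all the closure
  operations preserve countability, so this loses nothing. A class of groups is understood to be
  closed under isomorphism, which is made explicit in the rule \<open>iso\<close>; the quotient
  \<open>G Mod N\<close> has a different element type and therefore enters through an isomorphic copy \<open>Q\<close>.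
\<close>

inductive elementary_amenable_nat :: "nat monoid \<Rightarrow> bool" where
  finite: "group G \<Longrightarrow> finite (carrier G) \<Longrightarrow> elementary_amenable_nat G"
| abelian: "comm_group G \<Longrightarrow> elementary_amenable_nat G"
| iso: "elementary_amenable_nat G \<Longrightarrow> group H \<Longrightarrow> G \<cong> H \<Longrightarrow> elementary_amenable_nat H"
| extension: "N \<lhd> G \<Longrightarrow> elementary_amenable_nat (G\<lparr>carrier := N\<rparr>) \<Longrightarrow>
    elementary_amenable_nat Q \<Longrightarrow> G Mod N \<cong> Q \<Longrightarrow> elementary_amenable_nat G"
| union: "group G \<Longrightarrow> (\<And>n :: nat. subgroup (H n) G) \<Longrightarrow> (\<And>n. H n \<subseteq> H (Suc n)) \<Longrightarrow>
    (\<Union>n. H n) = carrier G \<Longrightarrow> (\<And>n. elementary_amenable_nat (G\<lparr>carrier := H n\<rparr>)) \<Longrightarrow>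
    elementary_amenable_nat G"
| subgroup: "elementary_amenable_nat G \<Longrightarrow> subgroup H G \<Longrightarrow>
    elementary_amenable_nat (G\<lparr>carrier := H\<rparr>)"
| quotient: "elementary_amenable_nat G \<Longrightarrow> N \<lhd> G \<Longrightarrow> group Q \<Longrightarrow> G Mod N \<cong> Q \<Longrightarrow>
    elementary_amenable_nat Q"

definition elementary_amenable_group :: "('a, 'b) monoid_scheme \<Rightarrow> bool" where
  "elementary_amenable_group G \<longleftrightarrow>
     group G \<and> (\<exists>H. elementary_amenable_nat H \<and> G \<cong> H)"

lemma elementary_amenable_nat_group: "elementary_amenable_nat G \<Longrightarrow> group G"
  by (induction rule: elementary_amenable_nat.induct)
    (auto simp: comm_group_def normal_def intro: group.subgroup_imp_group)

lemma elementary_amenable_group_nat_iff: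
  "elementary_amenable_group G \<longleftrightarrow> elementary_amenable_nat G"
  unfolding elementary_amenable_group_def
  by (meson elementary_amenable_nat.iso elementary_amenable_nat_group group.iso_sym iso_refl)

end

theory Submission
  imports Defs "HOL-Analysis.Function_Topology"
begin

text \<open>
  The example is Grigorchuk's group. It acts on the infinite rooted binary tree, whose vertices are the
  finite lists of booleans, and is generated by the flip \<open>a\<close> of the first letter and by the elements
  \<open>b\<close>, \<open>c\<close>, \<open>d\<close> of a four-group, which preserve the two subtrees below the root and act there as
  \<open>(a, c)\<close>, \<open>(a, d)\<close> and \<open>(1, b)\<close>.

  Why it is not elementary amenable: a finitely generated elementary amenable torsion group is finite
  (\<open>elementary_amenable_torsion_finite\<close>). Indeed the groups all of whose finitely generated
  torsion sections are finite include the finite and the abelian groups and are closed under all the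
  operations that generate the class of elementary amenable groups. Sections make subgroups and quotients
  harmless, and extensions are handled by Schreier's lemma. Grigorchuk's group, on the other hand, is an
  infinite torsion group (\<open>torsion_word\<close>, \<open>infinite_range_word_map\<close>).

  Why it is amenable: it has subexponential growth, so that some of its balls are almost invariant under
  translation, and a limit of the uniform distributions on such balls is an invariant measure
  (\<open>Folner_imp_amenable\<close>).

  Torsion and growth both come from one contraction property (\<open>section_weight_alternating\<close>). With
  suitable weights of the letters, a word of weight \<open>n\<close> in which flips alternate with elements of the
  four-group acts on the two subtrees by words whose weights add up to at most \<open>6 n / 7\<close>. Torsion
  follows by induction on the weight. For the growth, an element is essentially a pair of elements of
  smaller total weight; if the ball of radius \<open>n\<close> has at most \<open>K exp (t n)\<close> elements for all \<open>n\<close>, this yields the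
  same with a rate \<open>13 t / 14\<close> and another constant, and iterating brings the rate below any positive bound.
\<close>

section \<open>Torsion sections of elementary amenable groups\<close>

text \<open>
  The section meant here is the quotient of \<open>\<langle>S\<rangle>\<close> by its normal subgroup \<open>M\<close>. It is described by subsets of \<open>G\<close>,
  so that statements about it need no further element type.
\<close>

definition fg_torsion_section :: "('a, 'b) monoid_scheme \<Rightarrow> 'a set \<Rightarrow> 'a set \<Rightarrow> bool" where
  "fg_torsion_section G S M \<longleftrightarrow>
     finite S \<and> S \<subseteq> carrier G \<and> subgroup M G \<and> M \<subseteq> generate G S \<and>
     (\<forall>h\<in>generate G S. \<forall>m\<in>M. h \<otimes>\<^bsub>G\<^esub> m \<otimes>\<^bsub>G\<^esub> inv\<^bsub>G\<^esub> h \<in> M) \<and>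
     (\<forall>h\<in>generate G S. \<exists>n::nat>0. h [^]\<^bsub>G\<^esub> n \<in> M)"

definition finite_index :: "('a, 'b) monoid_scheme \<Rightarrow> 'a set \<Rightarrow> 'a set \<Rightarrow> bool" where
  "finite_index G M H \<longleftrightarrow> (\<exists>F. finite F \<and> F \<subseteq> H \<and> (\<forall>h\<in>H. \<exists>f\<in>F. \<exists>m\<in>M. h = f \<otimes>\<^bsub>G\<^esub> m))"

lemma finite_indexE:
  assumes "finite_index G M H"
  obtains F where "finite F" "F \<subseteq> H" "\<And>h. h \<in> H \<Longrightarrow> \<exists>f\<in>F. \<exists>m\<in>M. h = f \<otimes>\<^bsub>G\<^esub> m"
  using assms unfolding finite_index_def by blast

text \<open>
  The useful invariant speaks about sections, not only about subgroups: a free group has no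
  nontrivial torsion subgroups, but every group is a quotient of a free one, so a condition on torsion
  subgroups alone would not pass to quotients.
\<close>

definition fg_torsion_sections_finite :: "('a, 'b) monoid_scheme \<Rightarrow> bool" where
  "fg_torsion_sections_finite G \<longleftrightarrow>
     (\<forall>S M. fg_torsion_section G S M \<longrightarrow> finite_index G M (generate G S))"

text \<open>
  If \<open>f \<otimes> m\<close> lies in \<open>H\<close> for some \<open>m \<in> M \<subseteq> H\<close>, then \<open>f\<close> lies in \<open>H\<close>. Representatives outside \<open>H\<close> can
  therefore be dropped from a covering set.
\<close>

lemma (in group) finite_index_of_cover:
  assumes "subgroup H G" "M \<subseteq> H" "finite F" "F \<subseteq> carrier G" "subgroup M G"
    and cov: "\<And>h. h \<in> H \<Longrightarrow> \<exists>f\<in>F. \<exists>m\<in>M. h = f \<otimes> m"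
  shows "finite_index G M H"
  unfolding finite_index_def
proof (intro exI[of _ "F \<inter> H"] conjI ballI)
  fix h assume h: "h \<in> H"
  then obtain f m where fm: "f \<in> F" "m \<in> M" "h = f \<otimes> m"
    using cov by blast
  have "f = h \<otimes> inv m"
    using fm assms(4) subgroup.mem_carrier[OF assms(5)] by (simp add: m_assoc subset_iff)
  moreover have "inv m \<in> H" using fm(2) assms(2) subgroup.m_inv_closed[OF assms(1)] by auto
  ultimately have "f \<in> H" using h subgroup.m_closed[OF assms(1)] by simp
  then show "\<exists>f\<in>F \<inter> H. \<exists>m\<in>M. h = f \<otimes> m"
    using fm by blast
qed (use assms in auto)

text \<open>
  The elements \<open>g\<close> with \<open>g \<otimes> x \<in> A\<close> for all \<open>x \<in> A\<close> are closed under products. The inductive definition of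
  generated subgroups multiplies arbitrary elements; here it suffices to treat one generator on the left.
\<close>

lemma (in group) generate_subset_left_invariant:
  assumes S: "S \<subseteq> carrier G" and A: "A \<subseteq> carrier G" "\<one> \<in> A"
    and step: "\<And>s x. s \<in> S \<Longrightarrow> x \<in> A \<Longrightarrow> s \<otimes> x \<in> A"
    and inv_step: "\<And>s x. s \<in> S \<Longrightarrow> x \<in> A \<Longrightarrow> inv s \<otimes> x \<in> A"
  shows "generate G S \<subseteq> A"
proof
  fix g assume g: "g \<in> generate G S"
  have "\<forall>x\<in>A. g \<otimes> x \<in> A"
    using g
  proof (induction rule: generate.induct)
    case one
    then show ?case using A by auto
  next
    case (eng h1 h2)
    then show ?case
      using A(1) generate_in_carrier[OF S] by (metis m_assoc subsetD)
  qed (use step inv_step in auto)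
  then have "g \<otimes> \<one> \<in> A" using A by blast
  then show "g \<in> A" using g generate_in_carrier[OF S] by simp
qed

text \<open>
  Schreier's lemma. Let \<open>F\<close> be a finite set of coset representatives of \<open>K\<close> containing \<open>\<one>\<close>. For a
  generator \<open>s\<close> (or its inverse) and \<open>f \<in> F\<close> write \<open>s \<otimes> f = f' \<otimes> k\<close> with \<open>f' \<in> F\<close> and \<open>k \<in> K\<close>. If \<open>T\<close> contains these
  finitely many \<open>k\<close>, then the set of all \<open>f \<otimes> t\<close> with \<open>t \<in> \<langle>T\<rangle>\<close> is invariant under the generators, so it
  is the whole group. An element \<open>f \<otimes> t\<close> of \<open>K\<close> has \<open>f \<in> F \<inter> K\<close>, which is why these elements are put into \<open>T\<close>
  as well.
\<close>

lemma (in group) finite_index_subgroup_finitely_generated: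
  assumes S: "finite S" "S \<subseteq> carrier G" and K: "subgroup K G" "K \<subseteq> generate G S"
    and fin: "finite_index G K (generate G S)"
  shows "\<exists>T. finite T \<and> T \<subseteq> carrier G \<and> generate G T = K"
proof -
  let ?H = "generate G S"
  have H: "subgroup ?H G"
    by (rule generate_is_subgroup[OF S(2)])
  obtain F0 where F0: "finite F0" "F0 \<subseteq> ?H" "\<And>h. h \<in> ?H \<Longrightarrow> \<exists>f\<in>F0. \<exists>m\<in>K. h = f \<otimes> m"
    using fin unfolding finite_index_def by blast
  define F where "F = insert \<one> F0"
  have F: "finite F" "F \<subseteq> ?H" "\<one> \<in> F"
    using F0 subgroup.one_closed[OF H] by (auto simp: F_def)
  have FG: "F \<subseteq> carrier G" using F(2) subgroup.subset[OF H] by blast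
  define S' where "S' = S \<union> m_inv G ` S"
  have S': "finite S'" "S' \<subseteq> ?H"
    using S by (auto simp: S'_def intro: generate.incl generate.inv)
  have "\<exists>f' k. f' \<in> F \<and> k \<in> K \<and> s \<otimes> f = f' \<otimes> k" if "s \<in> S'" "f \<in> F" for s f
  proof -
    have "s \<otimes> f \<in> ?H" using that S' F by (meson generate.eng subsetD)
    then show ?thesis using F0(3) F_def by blast
  qed
  then obtain f' k where fk: "\<And>s f. s \<in> S' \<Longrightarrow> f \<in> F \<Longrightarrow> f' s f \<in> F \<and> k s f \<in> K \<and> s \<otimes> f = f' s f \<otimes> k s f"
    by metis
  define T where "T = case_prod k ` (S' \<times> F) \<union> (F \<inter> K)"
  have T: "finite T" "T \<subseteq> K"
    using F S' fk by (auto simp: T_def)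
  have KG: "K \<subseteq> carrier G" using K subgroup.subset by blast
  have TG: "T \<subseteq> carrier G" using T KG by blast
  have TT: "subgroup (generate G T) G" by (rule generate_is_subgroup[OF TG])
  let ?A = "{f \<otimes> t | f t. f \<in> F \<and> t \<in> generate G T}"
  have left: "s \<otimes> x \<in> ?A" if s: "s \<in> S'" and x: "x \<in> ?A" for s x
  proof -
    obtain f t where ft: "f \<in> F" "t \<in> generate G T" "x = f \<otimes> t" using x by blast
    have c: "s \<in> carrier G" "f \<in> carrier G" "t \<in> carrier G" "f' s f \<in> carrier G" "k s f \<in> carrier G"
      using s ft S' subgroup.subset[OF H] F fk[OF s ft(1)] KG subgroup.subset[OF TT] by auto
    have "s \<otimes> x = (s \<otimes> f) \<otimes> t" using c ft by (simp add: m_assoc)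
    also have "\<dots> = f' s f \<otimes> (k s f \<otimes> t)"
      using c fk[OF s ft(1)] by (simp add: m_assoc)
    finally have e: "s \<otimes> x = f' s f \<otimes> (k s f \<otimes> t)" .
    have "k s f \<in> T" using s ft by (force simp: T_def)
    then have "k s f \<otimes> t \<in> generate G T" using ft by (auto intro: generate.intros)
    then show ?thesis using e fk[OF s ft(1)] by blast
  qed
  have "?H \<subseteq> ?A"
  proof (rule generate_subset_left_invariant[OF S(2)])
    show "?A \<subseteq> carrier G" using FG subgroup.subset[OF TT] by auto
    show "\<one> \<in> ?A" using F(3) generate.one[of G T] by force
    show "s \<otimes> x \<in> ?A" if "s \<in> S" "x \<in> ?A" for s x
      using left[of s x] that unfolding S'_def by blast
    show "inv s \<otimes> x \<in> ?A" if "s \<in> S" "x \<in> ?A" for s x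
      using left[of "inv s" x] that unfolding S'_def by blast
  qed
  have TK: "generate G T \<subseteq> K" by (rule generate_subgroup_incl[OF T(2) K(1)])
  have "K \<subseteq> generate G T"
  proof
    fix x assume x: "x \<in> K"
    then obtain f t where ft: "f \<in> F" "t \<in> generate G T" "x = f \<otimes> t"
      using K(2) \<open>?H \<subseteq> ?A\<close> by blast
    have "f = x \<otimes> inv t"
      using ft x KG FG TK by (metis inv_solve_right subsetD)
    then have "f \<in> K" using x ft TK K(1) by (meson subgroup.m_closed subgroup.m_inv_closed subsetD)
    then have "f \<in> generate G T" using ft by (auto simp: T_def intro: generate.incl)
    then show "x \<in> generate G T" using ft by (simp add: generate.eng)
  qed
  then show ?thesis using T TG TK by blast
qed

lemma fg_torsion_sections_finite_of_finite:
  fixes G (structure)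
  assumes "group G" "finite (carrier G)"
  shows "fg_torsion_sections_finite G"
  unfolding fg_torsion_sections_finite_def
proof (intro allI impI)
  interpret group G by fact
  fix S M assume a: "fg_torsion_section G S M"
  then have S: "S \<subseteq> carrier G" and M: "subgroup M G" "M \<subseteq> generate G S"
    by (auto simp: fg_torsion_section_def)
  show "finite_index G M (generate G S)"
  proof (rule finite_index_of_cover[OF generate_is_subgroup[OF S] M(2) assms(2) subset_refl M(1)])
    fix h assume "h \<in> generate G S"
    then have "h \<in> carrier G" "h = h \<otimes> \<one>" using generate_in_carrier[OF S] by simp_all
    then show "\<exists>f\<in>carrier G. \<exists>m\<in>M. h = f \<otimes> m" using subgroup.one_closed[OF M(1)] by blast
  qed
qed

text \<open>
  If every generator \<open>s\<close> has a power \<open>s [^] n\<close> in \<open>M\<close>, the products of the powers \<open>s [^] i\<close> with \<open>i < n\<close>, one factor for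
  each generator, represent all cosets of \<open>M\<close>. They are collected one generator at a time.
\<close>

lemma fg_torsion_sections_finite_of_abelian:
  fixes G (structure)
  assumes "comm_group G"
  shows "fg_torsion_sections_finite G"
  unfolding fg_torsion_sections_finite_def
proof (intro allI impI)
  interpret comm_group G by fact
  fix S M assume a: "fg_torsion_section G S M"
  then have S: "finite S" "S \<subseteq> carrier G" and M: "subgroup M G" "M \<subseteq> generate G S"
    and tors: "\<And>h. h \<in> generate G S \<Longrightarrow> \<exists>n::nat>0. h [^] n \<in> M"
    by (auto simp: fg_torsion_section_def)
  have tors: "\<exists>n::nat>0. s [^] n \<in> M" if "s \<in> S" for s
    using that tors generate.incl by metis
  have MG: "\<And>m. m \<in> M \<Longrightarrow> m \<in> carrier G" using M by (meson subgroup.mem_carrier)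
  define cos where "cos F = {f \<otimes> m | f m. f \<in> F \<and> m \<in> M}" for F
  have cosI: "x \<in> cos F" if "x = f \<otimes> m" "f \<in> F" "m \<in> M" for x f m F
    unfolding cos_def using that by blast
  have cosE: "\<exists>f m. f \<in> F \<and> m \<in> M \<and> x = f \<otimes> m" if "x \<in> cos F" for x F
    using that unfolding cos_def by blast
  have "\<exists>F. finite F \<and> F \<subseteq> carrier G \<and> \<one> \<in> F \<and> (\<forall>s\<in>S. \<forall>f\<in>F. s \<otimes> f \<in> cos F)"
    using S tors
  proof (induction S rule: finite_induct)
    case empty
    then show ?case by (intro exI[of _ "{\<one>}"]) auto
  next
    case (insert s S)
    have "\<exists>F. finite F \<and> F \<subseteq> carrier G \<and> \<one> \<in> F \<and> (\<forall>s\<in>S. \<forall>f\<in>F. s \<otimes> f \<in> cos F)"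
      using insert.prems by (intro insert.IH) auto
    then obtain F where F: "finite F" "F \<subseteq> carrier G" "\<one> \<in> F"
      "\<And>t f. t \<in> S \<Longrightarrow> f \<in> F \<Longrightarrow> t \<otimes> f \<in> cos F" by blast
    obtain n :: nat where n: "n > 0" "s [^] n \<in> M" using insert.prems by blast
    have s: "s \<in> carrier G" using insert.prems by blast
    let ?F = "(\<lambda>(i, f). s [^] i \<otimes> f) ` ({..<n} \<times> F)"
    have mem: "s [^] i \<otimes> f \<in> ?F" if "i < n" "f \<in> F" for i f using that by auto
    have "t \<otimes> x \<in> cos ?F" if t: "t \<in> insert s S" and x: "x \<in> ?F" for t x
    proof -
      obtain i f where x': "i < n" "f \<in> F" "x = s [^] i \<otimes> f" using x by auto
      have f: "f \<in> carrier G" using x' F by auto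
      show ?thesis
      proof (cases "t = s")
        case True
        then have e: "t \<otimes> x = s [^] Suc i \<otimes> f"
          using s f x' by (metis m_assoc m_comm nat_pow_Suc nat_pow_closed)
        show ?thesis
        proof (cases "Suc i = n")
          case True
          have "t \<otimes> x = (s [^] (0::nat) \<otimes> f) \<otimes> s [^] n"
            unfolding e True using s f by (simp add: m_comm)
          then show ?thesis using mem[OF n(1) x'(2)] n(2) by (rule cosI)
        next
          case False
          then have "Suc i < n" using x' by simp
          then have "s [^] Suc i \<otimes> f \<in> ?F" by (rule mem) fact
          moreover have "t \<otimes> x = (s [^] Suc i \<otimes> f) \<otimes> \<one>" unfolding e using s f by simp
          ultimately show ?thesis using subgroup.one_closed[OF M(1)] by (intro cosI)
        qed
      next
        case False
        then have t: "t \<in> S" "t \<in> carrier G" using t insert.prems by auto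
        then obtain f' m where f': "f' \<in> F" "m \<in> M" "t \<otimes> f = f' \<otimes> m"
          using F(4)[OF _ x'(2)] cosE by meson
        have "f' \<in> carrier G" using f' F by auto
        have "t \<otimes> x = s [^] i \<otimes> (t \<otimes> f)" unfolding x' using s f t by (simp add: m_lcomm)
        also have "\<dots> = (s [^] i \<otimes> f') \<otimes> m"
          unfolding f' using s \<open>f' \<in> carrier G\<close> MG f' by (simp add: m_assoc)
        finally show ?thesis using mem[OF x'(1) f'(1)] f'(2) by (rule cosI)
      qed
    qed
    moreover have "\<one> \<in> ?F" using mem[OF n(1) F(3)] by simp
    moreover have "?F \<subseteq> carrier G" using s F(2) by auto
    moreover have "finite ?F" using F(1) by simp
    ultimately show ?case by (intro exI[of _ ?F] conjI ballI)
  qed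
  then obtain F where F: "finite F" "F \<subseteq> carrier G" "\<one> \<in> F"
    "\<And>t f. t \<in> S \<Longrightarrow> f \<in> F \<Longrightarrow> t \<otimes> f \<in> cos F" by blast
  have step: "s \<otimes> x \<in> cos F" if s: "s \<in> S" and x: "x \<in> cos F" for s x
  proof -
    obtain f m where fm: "f \<in> F" "m \<in> M" "x = f \<otimes> m" using cosE[OF x] by blast
    obtain f' m' where f': "f' \<in> F" "m' \<in> M" "s \<otimes> f = f' \<otimes> m'"
      using cosE[OF F(4)[OF s fm(1)]] by blast
    have c: "s \<in> carrier G" "f \<in> carrier G" "m \<in> carrier G" "f' \<in> carrier G" "m' \<in> carrier G"
      using s S fm f' F MG by auto
    have "s \<otimes> x = (s \<otimes> f) \<otimes> m" using c fm by (simp add: m_assoc)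
    also have "\<dots> = f' \<otimes> (m' \<otimes> m)" unfolding f' using c by (simp add: m_assoc)
    finally show ?thesis using f' fm subgroup.m_closed[OF M(1)] by (intro cosI)
  qed
  have cosG: "cos F \<subseteq> carrier G" using F MG by (auto simp: cos_def)
  have "generate G S \<subseteq> cos F"
  proof (rule generate_subset_left_invariant[OF S(2)])
    show "cos F \<subseteq> carrier G" by fact
    show "\<one> \<in> cos F" using F(3) subgroup.one_closed[OF M(1)] by (intro cosI[of _ \<one> \<one>]) auto
    show "s \<otimes> x \<in> cos F" if "s \<in> S" "x \<in> cos F" for s x using step that by blast
    show "inv s \<otimes> x \<in> cos F" if s: "s \<in> S" and x: "x \<in> cos F" for s x
    proof -
      obtain n :: nat where n: "n > 0" "s [^] n \<in> M" using tors s by blast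
      then obtain k where k: "n = Suc k" by (cases n) auto
      have pw: "s [^] i \<otimes> x \<in> cos F" for i :: nat
      proof (induction i)
        case 0
        then show ?case using x cosG by auto
      next
        case (Suc i)
        have "s [^] Suc i \<otimes> x = s \<otimes> (s [^] i \<otimes> x)"
          using s S x cosG by (metis m_assoc nat_pow_Suc2 nat_pow_closed subsetD)
        then show ?case using step[OF s Suc] by simp
      qed
      obtain f m where fm: "f \<in> F" "m \<in> M" "s [^] k \<otimes> x = f \<otimes> m" using cosE[OF pw[of k]] by blast
      have c: "s \<in> carrier G" "x \<in> carrier G" "f \<in> carrier G" "m \<in> carrier G"
        using s S x cosG fm F MG by auto
      \<comment> \<open>Modulo \<open>M\<close> the inverse of \<open>s\<close> is a positive power of \<open>s\<close>, and positive powers preserve the cosets.\<close>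
      have "inv s = s [^] k \<otimes> inv (s [^] n)"
      proof -
        have "s [^] n = s \<otimes> s [^] k" unfolding k using c by (simp add: m_comm)
        then have "inv (s [^] n) = inv (s [^] k) \<otimes> inv s" using c by (simp add: inv_mult_group)
        then show ?thesis using c by (simp add: m_assoc[symmetric])
      qed
      then have "inv s \<otimes> x = (s [^] k \<otimes> x) \<otimes> inv (s [^] n)"
        using c by (simp add: m_ac)
      also have "\<dots> = f \<otimes> (m \<otimes> inv (s [^] n))"
        unfolding fm using c by (simp add: m_assoc)
      finally have "inv s \<otimes> x = f \<otimes> (m \<otimes> inv (s [^] n))" .
      moreover have "m \<otimes> inv (s [^] n) \<in> M"
        using fm n subgroup.m_closed[OF M(1)] subgroup.m_inv_closed[OF M(1)] by simp
      ultimately show ?thesis using fm(1) by (intro cosI)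
    qed
  qed
  then have "\<exists>f\<in>F. \<exists>m\<in>M. h = f \<otimes> m" if "h \<in> generate G S" for h
    using that cosE by blast
  then show "finite_index G M (generate G S)"
    by (rule finite_index_of_cover[OF generate_is_subgroup[OF S(2)] M(2) F(1) F(2) M(1)])
qed

lemma (in group) fg_torsion_section_in_subgroup:
  assumes H: "subgroup H G" and "S \<subseteq> H"
  shows "fg_torsion_section (G\<lparr>carrier := H\<rparr>) S M \<longleftrightarrow> fg_torsion_section G S M"
proof -
  have g: "generate (G\<lparr>carrier := H\<rparr>) S = generate G S"
    by (rule generate_consistent[OF assms(2,1)])
  have sub: "generate G S \<subseteq> H" by (rule generate_subgroup_incl[OF assms(2,1)])
  have "subgroup M (G\<lparr>carrier := H\<rparr>) \<longleftrightarrow> subgroup M G" if "M \<subseteq> H"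
    using that H subgroup_incl[of M H] incl_subgroup[of H M] by blast
  moreover have "inv\<^bsub>G\<lparr>carrier := H\<rparr>\<^esub> h = inv h" if "h \<in> generate G S" for h
    using that sub m_inv_consistent[OF H] by blast
  ultimately show ?thesis
    unfolding fg_torsion_section_def g nat_pow_consistent[symmetric]
    using assms subgroup.subset[OF H] sub
    by (auto 4 3)
qed

lemma (in group) fg_torsion_sections_finite_subgroup:
  assumes H: "subgroup H G"
  shows "fg_torsion_sections_finite (G\<lparr>carrier := H\<rparr>) \<longleftrightarrow>
     (\<forall>S M. S \<subseteq> H \<longrightarrow> fg_torsion_section G S M \<longrightarrow> finite_index G M (generate G S))"
proof -
  have "finite_index (G\<lparr>carrier := H\<rparr>) M (generate (G\<lparr>carrier := H\<rparr>) S) \<longleftrightarrow>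
      finite_index G M (generate G S)" if "S \<subseteq> H" for S M
    using generate_consistent[OF that H] by (simp add: finite_index_def)
  moreover have "S \<subseteq> H" if "fg_torsion_section (G\<lparr>carrier := H\<rparr>) S M" for S M
    using that by (simp add: fg_torsion_section_def)
  ultimately show ?thesis
    using fg_torsion_section_in_subgroup[OF H] unfolding fg_torsion_sections_finite_def by metis
qed

text \<open>
  A section of \<open>Q\<close> is isomorphic to a section of \<open>G\<close>: lift the generators, and pull \<open>M'\<close> back to the
  subgroup that the lifts generate.
\<close>

lemma fg_torsion_sections_finite_of_surjection:
  fixes G (structure) and Q
  assumes "group G" "group Q" "\<phi> \<in> hom G Q" and surj: "\<phi> ` carrier G = carrier Q"
    and G: "fg_torsion_sections_finite G"
  shows "fg_torsion_sections_finite Q"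
  unfolding fg_torsion_sections_finite_def
proof (intro allI impI)
  interpret group_hom G Q \<phi> using assms by (simp add: group_hom_def group_hom_axioms_def)
  fix S' M' assume a: "fg_torsion_section Q S' M'"
  then have S': "finite S'" "S' \<subseteq> carrier Q" and M': "subgroup M' Q" "M' \<subseteq> generate Q S'"
    and nrm: "\<And>h m. h \<in> generate Q S' \<Longrightarrow> m \<in> M' \<Longrightarrow> h \<otimes>\<^bsub>Q\<^esub> m \<otimes>\<^bsub>Q\<^esub> inv\<^bsub>Q\<^esub> h \<in> M'"
    and tors: "\<And>h. h \<in> generate Q S' \<Longrightarrow> \<exists>n::nat>0. h [^]\<^bsub>Q\<^esub> n \<in> M'"
    by (auto simp: fg_torsion_section_def)
  obtain S where S: "S \<subseteq> carrier G" "finite S" "S' = \<phi> ` S"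
    using S' surj finite_subset_image by metis
  have H': "generate Q S' = \<phi> ` generate G S"
    using generate_img[OF S(1)] S(3) by simp
  define M where "M = {x \<in> generate G S. \<phi> x \<in> M'}"
  have HG: "\<And>x. x \<in> generate G S \<Longrightarrow> x \<in> carrier G" using G.generate_in_carrier[OF S(1)] .
  have H: "subgroup (generate G S) G" by (rule G.generate_is_subgroup[OF S(1)])
  have M: "subgroup M G"
    unfolding M_def
    using HG generate.one[of G S] generate.eng[of _ G S] subgroup.m_inv_closed[OF H]
      subgroup.one_closed[OF M'(1)] subgroup.m_closed[OF M'(1)] subgroup.m_inv_closed[OF M'(1)]
    by (intro subgroup.intro) auto
  have "fg_torsion_section G S M"
    unfolding fg_torsion_section_def
  proof (intro conjI ballI)
    fix h m assume h: "h \<in> generate G S" and m: "m \<in> M"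
    then show "h \<otimes> m \<otimes> inv h \<in> M"
      using nrm[of "\<phi> h" "\<phi> m"] HG subgroup.m_inv_closed[OF H h] unfolding M_def H'
      by (auto simp: generate.eng)
  next
    fix h assume h: "h \<in> generate G S"
    then obtain n :: nat where n: "n > 0" "\<phi> h [^]\<^bsub>Q\<^esub> n \<in> M'" using tors H' by blast
    have "h [^] n \<in> generate G S" by (induction n) (auto simp: generate.one generate.eng h)
    then show "\<exists>n::nat>0. h [^] n \<in> M"
      using n HG[OF h] unfolding M_def by (auto simp: hom_nat_pow)
  qed (use S M in \<open>auto simp: M_def\<close>)
  then have "finite_index G M (generate G S)"
    using G by (simp add: fg_torsion_sections_finite_def)
  then obtain F where F: "finite F" "F \<subseteq> generate G S"
    "\<And>h. h \<in> generate G S \<Longrightarrow> \<exists>f\<in>F. \<exists>m\<in>M. h = f \<otimes> m"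
    by (rule finite_indexE) iprover
  show "finite_index Q M' (generate Q S')"
    unfolding finite_index_def
  proof (intro exI[of _ "\<phi> ` F"] conjI ballI)
    fix h' assume "h' \<in> generate Q S'"
    then obtain h where h: "h \<in> generate G S" "h' = \<phi> h" using H' by blast
    then obtain f m where "f \<in> F" "m \<in> M" "h = f \<otimes> m" using F(3) by blast
    then show "\<exists>f\<in>\<phi> ` F. \<exists>m\<in>M'. h' = f \<otimes>\<^bsub>Q\<^esub> m"
      using h F(2) HG M_def by (metis (no_types, lifting) hom_mult image_eqI mem_Collect_eq subsetD)
  qed (use F H' in auto)
qed

text \<open>
  This serves to collect the factors from a normal subgroup on the right of a product.
\<close>

lemma (in group) mult_eq_mult_conjugate:
  assumes "x \<in> carrier G" "l \<in> carrier G" "m \<in> carrier G"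
  shows "x \<otimes> (l \<otimes> m) = l \<otimes> ((inv l \<otimes> x \<otimes> l) \<otimes> m)"
proof -
  have "l \<otimes> (inv l \<otimes> (x \<otimes> (l \<otimes> m))) = x \<otimes> (l \<otimes> m)"
    using assms by (simp add: m_assoc[symmetric])
  then show ?thesis using assms by (simp add: m_assoc)
qed

text \<open>
  Let \<open>H = \<langle>S\<rangle>\<close>. The image of \<open>H\<close> modulo the image of \<open>M\<close> is a finitely generated torsion section of
  \<open>Q\<close>, so \<open>K\<close>, the part of \<open>H\<close> that \<open>\<phi>\<close> maps into the image of \<open>M\<close>, has finite index in
  \<open>H\<close>, and by Schreier's lemma \<open>K\<close> is finitely generated. Each of its generators splits as \<open>n \<otimes> m\<close> with \<open>n\<close> in
  the kernel and \<open>m \<in> M\<close>. Let \<open>L\<close> be generated by the parts \<open>n\<close>. As \<open>M\<close> is normal in \<open>H\<close>, every element of \<open>K\<close>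
  is a product of one of \<open>L\<close> and one of \<open>M\<close>. The quotient of \<open>L\<close> by \<open>L \<inter> M\<close> is a finitely generated
  torsion section of the kernel, so it is finite too.
\<close>

lemma fg_torsion_sections_finite_of_extension:
  fixes G (structure) and Q
  assumes "group G" "group Q" "\<phi> \<in> hom G Q"
    and ker: "fg_torsion_sections_finite (G\<lparr>carrier := kernel G Q \<phi>\<rparr>)"
    and Q: "fg_torsion_sections_finite Q"
  shows "fg_torsion_sections_finite G"
  unfolding fg_torsion_sections_finite_def
proof (intro allI impI)
  interpret group_hom G Q \<phi> using assms by (simp add: group_hom_def group_hom_axioms_def)
  let ?N = "kernel G Q \<phi>"
  have N: "subgroup ?N G" by (rule subgroup_kernel)
  fix S M assume a: "fg_torsion_section G S M"
  then have S: "finite S" "S \<subseteq> carrier G" and M: "subgroup M G" "M \<subseteq> generate G S"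
    and nrm: "\<And>h m. h \<in> generate G S \<Longrightarrow> m \<in> M \<Longrightarrow> h \<otimes> m \<otimes> inv h \<in> M"
    and tors: "\<And>h. h \<in> generate G S \<Longrightarrow> \<exists>n::nat>0. h [^] n \<in> M"
    by (auto simp: fg_torsion_section_def)
  let ?H = "generate G S"
  have H: "subgroup ?H G" by (rule G.generate_is_subgroup[OF S(2)])
  have HG: "\<And>x. x \<in> ?H \<Longrightarrow> x \<in> carrier G" using G.generate_in_carrier[OF S(2)] .
  have MG: "\<And>m. m \<in> M \<Longrightarrow> m \<in> carrier G" using M HG by blast
  have img: "generate Q (\<phi> ` S) = \<phi> ` ?H" using generate_img[OF S(2)] by simp
  have subM: "subgroup (\<phi> ` M) Q" by (rule subgroup_img_is_subgroup[OF M(1)])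
  have "fg_torsion_section Q (\<phi> ` S) (\<phi> ` M)"
    unfolding fg_torsion_section_def img
  proof (intro conjI ballI)
    fix h' m' assume "h' \<in> \<phi> ` ?H" "m' \<in> \<phi> ` M"
    then obtain h m where hm: "h \<in> ?H" "m \<in> M" "h' = \<phi> h" "m' = \<phi> m" by blast
    then have "h' \<otimes>\<^bsub>Q\<^esub> m' \<otimes>\<^bsub>Q\<^esub> inv\<^bsub>Q\<^esub> h' = \<phi> (h \<otimes> m \<otimes> inv h)" using HG MG by simp
    then show "h' \<otimes>\<^bsub>Q\<^esub> m' \<otimes>\<^bsub>Q\<^esub> inv\<^bsub>Q\<^esub> h' \<in> \<phi> ` M" using nrm hm by blast
  next
    fix h' assume "h' \<in> \<phi> ` ?H"
    then obtain h where h: "h \<in> ?H" "h' = \<phi> h" by blast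
    then show "\<exists>n::nat>0. h' [^]\<^bsub>Q\<^esub> n \<in> \<phi> ` M"
      using tors[of h] HG[of h] by (metis hom_nat_pow image_eqI)
  qed (use S M subM HG in auto)
  then have "finite_index Q (\<phi> ` M) (\<phi> ` ?H)"
    using Q img unfolding fg_torsion_sections_finite_def by metis
  then obtain F' where F': "finite F'" "F' \<subseteq> \<phi> ` ?H"
    "\<And>h. h \<in> \<phi> ` ?H \<Longrightarrow> \<exists>f\<in>F'. \<exists>m\<in>\<phi> ` M. h = f \<otimes>\<^bsub>Q\<^esub> m"
    by (rule finite_indexE) iprover
  obtain F where F: "F \<subseteq> ?H" "finite F" "F' = \<phi> ` F"
    using F' finite_subset_image by metis
  define K where "K = {k \<in> ?H. \<phi> k \<in> \<phi> ` M}"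
  have K: "subgroup K G" "K \<subseteq> ?H"
    unfolding K_def
    using HG generate.one[of G S] generate.eng[of _ G S] subgroup.m_inv_closed[OF H]
      subgroup.one_closed[OF subM] subgroup.m_closed[OF subM] subgroup.m_inv_closed[OF subM]
    by (auto intro!: subgroup.intro)
  have KG: "\<And>x. x \<in> K \<Longrightarrow> x \<in> carrier G" using K HG by blast
  have FK: "\<exists>f\<in>F. \<exists>k\<in>K. h = f \<otimes> k" if h: "h \<in> ?H" for h
  proof -
    obtain f m where fm: "f \<in> F" "m \<in> M" "\<phi> h = \<phi> f \<otimes>\<^bsub>Q\<^esub> \<phi> m"
      using F'(3) h F(3) by blast
    have c: "f \<in> carrier G" "m \<in> carrier G" "h \<in> carrier G" "f \<in> ?H"
      using fm h F HG MG by auto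
    let ?k = "inv f \<otimes> h"
    have "\<phi> ?k = \<phi> m" using c fm by (simp add: H.inv_solve_left')
    moreover have "?k \<in> ?H" using c h subgroup.m_inv_closed[OF H] by (simp add: generate.eng)
    ultimately have "?k \<in> K" using fm by (auto simp: K_def)
    moreover have "h = f \<otimes> ?k" using c by (simp add: G.m_assoc[symmetric])
    ultimately show ?thesis using fm by blast
  qed
  then have "finite_index G K ?H" using F unfolding finite_index_def by blast
  then obtain T where T: "finite T" "T \<subseteq> carrier G" "generate G T = K"
    using G.finite_index_subgroup_finitely_generated[OF S K] by blast
  have "\<exists>n m. m \<in> M \<and> n \<in> ?N \<and> n \<in> ?H \<and> t = n \<otimes> m" if t: "t \<in> T" for t
  proof -
    have "t \<in> K" using T t generate.incl by metis
    then obtain m where m: "m \<in> M" "\<phi> t = \<phi> m" "t \<in> ?H" by (auto simp: K_def)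
    have c: "t \<in> carrier G" "m \<in> carrier G" "m \<in> ?H" using m HG MG M by auto
    have "t \<otimes> inv m \<in> ?N" using c m by (simp add: kernel_def)
    moreover have "t \<otimes> inv m \<in> ?H" using c m subgroup.m_inv_closed[OF H] by (simp add: generate.eng)
    moreover have "t = t \<otimes> inv m \<otimes> m" using c by (simp add: G.m_assoc)
    ultimately show ?thesis using m by blast
  qed
  then obtain \<nu> \<mu> where \<nu>: "\<And>t. t \<in> T \<Longrightarrow> \<mu> t \<in> M \<and> \<nu> t \<in> ?N \<and> \<nu> t \<in> ?H \<and> t = \<nu> t \<otimes> \<mu> t"
    by metis
  let ?T = "\<nu> ` T"
  let ?L = "generate G ?T"
  have TH: "?T \<subseteq> ?H" and TN: "?T \<subseteq> ?N" using \<nu> by auto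
  have TG: "?T \<subseteq> carrier G" using TH HG by blast
  have L: "subgroup ?L G" by (rule G.generate_is_subgroup[OF TG])
  have LH: "?L \<subseteq> ?H" by (rule G.generate_subgroup_incl[OF TH H])
  have LG: "\<And>l. l \<in> ?L \<Longrightarrow> l \<in> carrier G" using LH HG by blast
  have nrm': "inv h \<otimes> m \<otimes> h \<in> M" if "h \<in> ?H" "m \<in> M" for h m
    using nrm[of "inv h" m] that HG subgroup.m_inv_closed[OF H] by simp
  let ?A = "{l \<otimes> m | l m. l \<in> ?L \<and> m \<in> M}"
  have "generate G T \<subseteq> ?A"
  proof (rule G.generate_subset_left_invariant[OF T(2)])
    show "?A \<subseteq> carrier G" using LG MG by auto
    show "\<one> \<in> ?A" using generate.one[of G ?T] subgroup.one_closed[OF M(1)] by force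
  next
    fix t x assume t: "t \<in> T" and x: "x \<in> ?A"
    obtain l m where lm: "l \<in> ?L" "m \<in> M" "x = l \<otimes> m" using x by blast
    note n = \<nu>[OF t]
    have c: "l \<in> carrier G" "m \<in> carrier G" "\<nu> t \<in> carrier G" "\<mu> t \<in> carrier G"
      using lm n LG MG HG by auto
    have nL: "\<nu> t \<in> ?L" using t by (auto intro: generate.incl)
    have lH: "l \<in> ?H" using lm LH by blast
    have "t \<otimes> x = (\<nu> t \<otimes> \<mu> t) \<otimes> (l \<otimes> m)" using n lm by metis
    also have "\<dots> = \<nu> t \<otimes> (\<mu> t \<otimes> (l \<otimes> m))"
      using c by (simp add: G.m_assoc)
    also have "\<dots> = (\<nu> t \<otimes> l) \<otimes> ((inv l \<otimes> \<mu> t \<otimes> l) \<otimes> m)"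
      using c G.mult_eq_mult_conjugate[of "\<mu> t" l m] by (simp add: G.m_assoc)
    finally have "t \<otimes> x = (\<nu> t \<otimes> l) \<otimes> ((inv l \<otimes> \<mu> t \<otimes> l) \<otimes> m)" .
    moreover have "\<nu> t \<otimes> l \<in> ?L" using nL lm by (simp add: generate.eng)
    moreover have "(inv l \<otimes> \<mu> t \<otimes> l) \<otimes> m \<in> M"
      using nrm'[OF lH] n lm M(1) by (blast intro: subgroup.m_closed)
    ultimately show "t \<otimes> x \<in> ?A" by blast
    define l' where "l' = inv (\<nu> t) \<otimes> l"
    have l': "l' \<in> ?L" unfolding l'_def using nL lm subgroup.m_inv_closed[OF L] by (simp add: generate.eng)
    have l'c: "l' \<in> carrier G" using l' LG by blast
    have nl: "l = \<nu> t \<otimes> l'" unfolding l'_def using c by (simp add: G.m_assoc[symmetric])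
    have "inv t \<otimes> x = (inv (\<mu> t) \<otimes> inv (\<nu> t)) \<otimes> (l \<otimes> m)"
      using n lm c by (metis G.inv_mult_group)
    also have "\<dots> = inv (\<mu> t) \<otimes> (l' \<otimes> m)" unfolding l'_def using c by (simp add: G.m_assoc)
    also have "\<dots> = l' \<otimes> ((inv l' \<otimes> inv (\<mu> t) \<otimes> l') \<otimes> m)"
      using c l'c by (intro G.mult_eq_mult_conjugate) auto
    finally have "inv t \<otimes> x = l' \<otimes> ((inv l' \<otimes> inv (\<mu> t) \<otimes> l') \<otimes> m)" .
    moreover have "(inv l' \<otimes> inv (\<mu> t) \<otimes> l') \<otimes> m \<in> M"
      using nrm'[of l' "inv (\<mu> t)"] l' LH n lm M(1)
      by (meson subgroup.m_closed subgroup.m_inv_closed subsetD)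
    ultimately show "inv t \<otimes> x \<in> ?A" using l' by blast
  qed
  then have KA: "K \<subseteq> ?A" using T by simp
  have MiL: "subgroup (M \<inter> ?L) G" by (rule G.subgroups_Inter_pair[OF M(1) L])
  have "fg_torsion_section G ?T (M \<inter> ?L)"
    unfolding fg_torsion_section_def
  proof (intro conjI ballI)
    fix h m assume h: "h \<in> ?L" and m: "m \<in> M \<inter> ?L"
    then show "h \<otimes> m \<otimes> inv h \<in> M \<inter> ?L"
      using nrm LH subgroup.m_inv_closed[OF L] by (auto simp: generate.eng)
  next
    fix h assume h: "h \<in> ?L"
    then obtain n :: nat where n: "n > 0" "h [^] n \<in> M" using tors LH by blast
    have "h [^] n \<in> ?L" by (induction n) (auto simp: generate.one generate.eng h)
    then show "\<exists>n::nat>0. h [^] n \<in> M \<inter> ?L" using n by blast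
  qed (use T TG MiL in auto)
  then have "finite_index G (M \<inter> ?L) ?L"
    using ker TN G.fg_torsion_sections_finite_subgroup[OF N] by metis
  then obtain E where E: "finite E" "E \<subseteq> ?L" "\<And>h. h \<in> ?L \<Longrightarrow> \<exists>e\<in>E. \<exists>m\<in>M \<inter> ?L. h = e \<otimes> m"
    by (rule finite_indexE) iprover
  let ?F = "(\<lambda>(f, e). f \<otimes> e) ` (F \<times> E)"
  have FG: "F \<subseteq> carrier G" and EG: "E \<subseteq> carrier G" using F(1) E(2) HG LG by blast+
  show "finite_index G M ?H"
  proof (rule G.finite_index_of_cover[OF H M(2) _ _ M(1)])
    show "finite ?F" using F E by simp
    show "?F \<subseteq> carrier G" using FG EG by auto
    fix h assume "h \<in> ?H"
    then obtain f k where fk: "f \<in> F" "k \<in> K" "h = f \<otimes> k" using FK by blast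
    then obtain l m where lm: "l \<in> ?L" "m \<in> M" "k = l \<otimes> m" using KA by blast
    obtain e m' where em: "e \<in> E" "m' \<in> M" "l = e \<otimes> m'" using E(3)[OF lm(1)] by blast
    have "f \<in> carrier G" "e \<in> carrier G" "m \<in> carrier G" "m' \<in> carrier G"
      using fk em lm FG EG MG by auto
    then have "h = (f \<otimes> e) \<otimes> (m' \<otimes> m)" unfolding fk lm em by (simp add: G.m_assoc)
    moreover have "m' \<otimes> m \<in> M" using em lm M(1) by (blast intro: subgroup.m_closed)
    moreover have "f \<otimes> e \<in> ?F" using fk em by force
    ultimately show "\<exists>f\<in>?F. \<exists>m\<in>M. h = f \<otimes> m" by blast
  qed
qed

text \<open>
  A finite generating set lies in one of the subgroups of the increasing chain.
\<close>

lemma fg_torsion_sections_finite_of_union: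
  fixes H :: "nat \<Rightarrow> 'a set"
  assumes "group G" and sub: "\<And>n. subgroup (H n) G" and mono: "\<And>n. H n \<subseteq> H (Suc n)"
    and un: "(\<Union>n. H n) = carrier G" and fin: "\<And>n. fg_torsion_sections_finite (G\<lparr>carrier := H n\<rparr>)"
  shows "fg_torsion_sections_finite G"
  unfolding fg_torsion_sections_finite_def
proof (intro allI impI)
  interpret group G by fact
  fix S M assume a: "fg_torsion_section G S M"
  then have S: "finite S" "S \<subseteq> (\<Union>n. H n)" by (auto simp: fg_torsion_section_def un)
  have "\<exists>n. S \<subseteq> H n"
    using S
  proof (induction S rule: finite_induct)
    case (insert s S)
    then obtain m n where "s \<in> H m" "S \<subseteq> H n" by auto
    moreover have "H m \<subseteq> H (max m n)" "H n \<subseteq> H (max m n)"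
      by (rule lift_Suc_mono_le[of H, OF mono]; simp)+
    ultimately have "insert s S \<subseteq> H (max m n)" by blast
    then show ?case by blast
  qed auto
  then obtain n where "S \<subseteq> H n" by blast
  then show "finite_index G M (generate G S)"
    using fin[of n] a unfolding fg_torsion_sections_finite_subgroup[OF sub] by blast
qed

text \<open>
  The quotient and the isomorphism of the defining rules compose to a homomorphism from \<open>G\<close> onto \<open>Q\<close>; for an
  extension its kernel is \<open>N\<close>.
\<close>

lemma elementary_amenable_fg_torsion_sections_finite:
  "elementary_amenable_nat G \<Longrightarrow> fg_torsion_sections_finite G"
proof (induction rule: elementary_amenable_nat.induct)
  case (finite G)
  then show ?case by (rule fg_torsion_sections_finite_of_finite)
next
  case (abelian G)
  then show ?case by (rule fg_torsion_sections_finite_of_abelian)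
next
  case (iso G H)
  then obtain \<phi> where "\<phi> \<in> iso G H" by (auto simp: is_iso_def)
  then show ?case
    using iso elementary_amenable_nat_group
    by (intro fg_torsion_sections_finite_of_surjection[of G H \<phi>]) (auto simp: iso_def bij_betw_def)
next
  case (extension N G Q)
  interpret N: normal N G by fact
  obtain \<psi> where \<psi>: "\<psi> \<in> iso (G Mod N) Q" using extension by (auto simp: is_iso_def)
  have Q: "group Q" using extension elementary_amenable_nat_group by blast
  interpret \<psi>: group_hom "G Mod N" Q \<psi>
    using \<psi> Q N.factorgroup_is_group by (simp add: group_hom_def group_hom_axioms_def iso_def)
  let ?\<phi> = "\<psi> \<circ> (#>\<^bsub>G\<^esub>) N"
  have hom: "?\<phi> \<in> hom G Q"
    using hom_compose[OF N.r_coset_hom_Mod \<psi>.homh] by simp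
  have inj: "inj_on \<psi> (carrier (G Mod N))"
    using \<psi> by (simp add: iso_def bij_betw_def)
  have "kernel G Q ?\<phi> = N"
  proof -
    have "?\<phi> x = \<one>\<^bsub>Q\<^esub> \<longleftrightarrow> x \<in> N" if x: "x \<in> carrier G" for x
    proof -
      have "N #>\<^bsub>G\<^esub> x \<in> carrier (G Mod N)" using x by (auto simp: FactGroup_def RCOSETS_def)
      then have "?\<phi> x = \<one>\<^bsub>Q\<^esub> \<longleftrightarrow> N #>\<^bsub>G\<^esub> x = \<one>\<^bsub>G Mod N\<^esub>"
        using inj_on_eq_iff[OF inj _ \<psi>.G.one_closed] \<psi>.hom_one by (metis comp_apply)
      also have "\<dots> \<longleftrightarrow> x \<in> N"
        using x N.rcos_self N.rcos_const N.subgroup_axioms by (auto simp: FactGroup_def)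
      finally show ?thesis .
    qed
    then show ?thesis using N.subset by (auto simp: kernel_def)
  qed
  then show ?case
    using fg_torsion_sections_finite_of_extension[OF N.is_group Q hom] extension.IH by simp
next
  case (union G H)
  then show ?case by (intro fg_torsion_sections_finite_of_union[of G H])
next
  case (subgroup G H)
  interpret group G using subgroup elementary_amenable_nat_group by blast
  show ?case
    using subgroup unfolding fg_torsion_sections_finite_subgroup[OF subgroup(2)]
    by (simp add: fg_torsion_sections_finite_def)
next
  case (quotient G N Q)
  interpret N: normal N G by fact
  obtain \<psi> where \<psi>: "\<psi> \<in> iso (G Mod N) Q" using quotient by (auto simp: is_iso_def)
  have "\<psi> \<circ> (#>\<^bsub>G\<^esub>) N \<in> hom G Q"
    using \<psi> by (intro hom_compose[OF N.r_coset_hom_Mod]) (simp add: iso_def)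
  moreover have "(\<psi> \<circ> (#>\<^bsub>G\<^esub>) N) ` carrier G = carrier Q"
    using \<psi> unfolding iso_def bij_betw_def by (auto simp: FactGroup_def RCOSETS_def image_comp)
  ultimately show ?case
    using quotient.hyps(3) quotient.IH
    by (intro fg_torsion_sections_finite_of_surjection[OF N.is_group, of Q "\<psi> \<circ> (#>\<^bsub>G\<^esub>) N"])
qed

text \<open>
  Here the group itself is a torsion section of itself, with trivial \<open>M\<close>.
\<close>

theorem elementary_amenable_torsion_finite:
  fixes G (structure)
  assumes EA: "elementary_amenable_group G" and fg: "finitely_generated_group G"
    and tors: "\<And>g. g \<in> carrier G \<Longrightarrow> \<exists>n::nat>0. g [^]\<^bsub>G\<^esub> n = \<one>\<^bsub>G\<^esub>"
  shows "finite (carrier G)"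
proof -
  obtain K \<psi> where K: "elementary_amenable_nat K" "\<psi> \<in> iso G K"
    using EA by (auto simp: elementary_amenable_group_def is_iso_def)
  have "group K" using K elementary_amenable_nat_group by blast
  interpret group G using EA by (simp add: elementary_amenable_group_def)
  obtain \<phi> where "\<phi> \<in> iso K G" using K iso_set_sym by blast
  then have fin: "fg_torsion_sections_finite G"
    using elementary_amenable_fg_torsion_sections_finite[OF K(1)] \<open>group K\<close> group_axioms
    by (intro fg_torsion_sections_finite_of_surjection[of K G \<phi>]) (auto simp: iso_def bij_betw_def)
  obtain S where S: "finite S" "S \<subseteq> carrier G" "generate G S = carrier G"
    using fg by (auto simp: finitely_generated_group_def)
  have "fg_torsion_section G S {\<one>}"
    unfolding fg_torsion_section_def using S tors triv_subgroup by auto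
  then have "finite_index G {\<one>} (carrier G)"
    using fin S(3) unfolding fg_torsion_sections_finite_def by metis
  then obtain F where F: "finite F" "F \<subseteq> carrier G"
    "\<And>h. h \<in> carrier G \<Longrightarrow> \<exists>f\<in>F. \<exists>m\<in>{\<one>}. h = f \<otimes> m"
    by (rule finite_indexE) iprover
  have "carrier G \<subseteq> F"
  proof
    fix h assume "h \<in> carrier G"
    then obtain f where "f \<in> F" "h = f \<otimes> \<one>" using F(3) by blast
    then show "h \<in> F" using F(2) by auto
  qed
  then show ?thesis using F(1) finite_subset by blast
qed

section \<open>The action of Grigorchuk's group on the binary tree\<close>

datatype klein = KOne | KB | KC | KD

fun kmul :: "klein \<Rightarrow> klein \<Rightarrow> klein" where
  "kmul KOne y = y"
| "kmul x KOne = x"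
| "kmul KB KC = KD" | "kmul KC KB = KD"
| "kmul KB KD = KC" | "kmul KD KB = KC"
| "kmul KC KD = KB" | "kmul KD KC = KB"
| "kmul _ _ = KOne"

text \<open>
  The generators \<open>b\<close>, \<open>c\<close>, \<open>d\<close> fix the two subtrees below the root. On the subtree of \<open>True\<close> they act as \<open>c\<close>, \<open>d\<close>, \<open>b\<close>;
  on the subtree of \<open>False\<close> the first two flip the top letter and \<open>d\<close> acts trivially.
\<close>

fun shift :: "klein \<Rightarrow> klein" where
  "shift KOne = KOne" | "shift KB = KC" | "shift KC = KD" | "shift KD = KB"

fun flips_left :: "klein \<Rightarrow> bool" where
  "flips_left x \<longleftrightarrow> x = KB \<or> x = KC"

fun flip :: "bool list \<Rightarrow> bool list" where
  "flip [] = []" | "flip (v # t) = (\<not> v) # t"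

fun act :: "klein \<Rightarrow> bool list \<Rightarrow> bool list" where
  "act x [] = []"
| "act x (True # t) = True # act (shift x) t"
| "act x (False # t) = False # (if flips_left x then flip t else t)"

lemma flip_flip [simp]: "flip (flip t) = t"
  by (cases t) auto

lemma shift_kmul: "shift (kmul x y) = kmul (shift x) (shift y)"
  by (cases x; cases y) auto

lemma act_kmul: "act (kmul x y) t = act x (act y t)"
proof (induction t arbitrary: x y)
  case (Cons v t)
  have "flips_left (kmul x y) \<longleftrightarrow> (flips_left x \<noteq> flips_left y)" by (cases x; cases y) auto
  then show ?case using Cons by (cases v) (auto simp: shift_kmul simp del: flips_left.simps)
qed simp

lemma act_KOne [simp]: "act KOne t = t"
  by (induction KOne t rule: act.induct) auto

lemma act_involution: "act x (act x t) = t"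
  using act_kmul[of x x t] by (cases x) auto

text \<open>
  The letter \<open>Spin KOne\<close> acts trivially and has weight 0 below. Admitting it lets every element be written in the
  alternating form \<open>x a y\<^sub>1 a y\<^sub>2 \<dots> a y\<^sub>k\<close> without cancelling equal neighbours.
\<close>

datatype letter = Flip | Spin klein

fun letter_map :: "letter \<Rightarrow> bool list \<Rightarrow> bool list" where
  "letter_map Flip = flip" | "letter_map (Spin x) = act x"

fun word_map :: "letter list \<Rightarrow> bool list \<Rightarrow> bool list" where
  "word_map [] = id"
| "word_map (l # u) = letter_map l \<circ> word_map u"

lemma word_map_append: "word_map (u @ w) = word_map u \<circ> word_map w"
  by (induction u) auto

lemma word_map_Nil_arg: "word_map u [] = []"
proof (induction u)
  case (Cons l u)
  then show ?case by (cases l) auto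
qed simp

lemma letter_map_involution: "letter_map l (letter_map l t) = t"
  by (cases l) (auto simp: act_involution)

lemma word_map_rev: "word_map (rev u) (word_map u t) = t"
proof (induction u arbitrary: t)
  case (Cons l u)
  then show ?case by (simp add: word_map_append letter_map_involution)
qed simp

text \<open>
  A vertex of the tree is read from the root downwards. A word either preserves or exchanges the
  two subtrees below the root, and then acts on each of them by another word, its section; see
  \<open>word_map_Cons_arg\<close>. The last letter of a word acts first, so the subtree on which a letter acts is found from the letters
  to its right.
\<close>

fun swaps_root :: "letter list \<Rightarrow> bool" where
  "swaps_root [] = False"
| "swaps_root (Flip # u) = (\<not> swaps_root u)"
| "swaps_root (Spin x # u) = swaps_root u"

fun section_word :: "bool \<Rightarrow> letter list \<Rightarrow> letter list" where
  "section_word v [] = []"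
| "section_word v (Flip # u) = section_word v u"
| "section_word v (Spin x # u) =
     (if v \<noteq> swaps_root u then [Spin (shift x)] else if flips_left x then [Flip] else []) @ section_word v u"

lemma word_map_Cons_arg:
  "word_map u (v # t) = (v \<noteq> swaps_root u) # word_map (section_word v u) t"
proof (induction u)
  case (Cons l u)
  show ?case
  proof (cases l)
    case Flip
    then show ?thesis using Cons by simp
  next
    case (Spin x)
    then show ?thesis using Cons by (cases "v \<noteq> swaps_root u") (auto simp: word_map_append)
  qed
qed simp

lemma swaps_root_append: "swaps_root (u @ w) \<longleftrightarrow> (swaps_root u \<noteq> swaps_root w)"
  by (induction u rule: swaps_root.induct) auto

lemma section_word_append:
  "section_word v (u @ w) = section_word (v \<noteq> swaps_root w) u @ section_word v w"
  by (induction v u rule: section_word.induct) (auto simp: swaps_root_append)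

section \<open>Contraction of section words\<close>

text \<open>
  In an alternating word a letter \<open>x\<close> comes with a flip, together of weight \<open>w(x) + 3\<close>. To the two sections it contributes
  \<open>w(shift x)\<close>, and 3 more if it flips below \<open>False\<close>. For \<open>b\<close>, \<open>c\<close>, \<open>d\<close>, \<open>1\<close> the weights below give the pairs \<open>(7, 6)\<close>, \<open>(6, 5)\<close>,
  \<open>(5, 4)\<close>, \<open>(3, 0)\<close>, so the ratio is at most \<open>6/7\<close>. The weights of \<open>b\<close>, \<open>c\<close>, \<open>d\<close> also satisfy the triangle
  inequalities, so merging neighbouring letters never makes a word heavier.
\<close>

fun letter_weight :: "letter \<Rightarrow> nat" where
  "letter_weight Flip = 3"
| "letter_weight (Spin KOne) = 0"
| "letter_weight (Spin KB) = 4"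
| "letter_weight (Spin KC) = 3"
| "letter_weight (Spin KD) = 2"

definition weight :: "letter list \<Rightarrow> nat" where
  "weight u = sum_list (map letter_weight u)"

lemma weight_simps [simp]:
  "weight [] = 0" "weight (l # u) = letter_weight l + weight u" "weight (u @ w) = weight u + weight w"
  by (auto simp: weight_def)

lemma letter_weight_kmul:
  "letter_weight (Spin (kmul x y)) \<le> letter_weight (Spin x) + letter_weight (Spin y)"
  by (cases x; cases y) auto

fun alternating :: "klein list \<Rightarrow> letter list" where
  "alternating [] = []"
| "alternating (x # xs) = Flip # Spin x # alternating xs"

lemma alternating_append: "alternating (xs @ ys) = alternating xs @ alternating ys"
  by (induction xs) auto

lemma weight_alternating_ge: "3 * length xs \<le> weight (alternating xs)"
  by (induction xs) auto

lemma alternating_form: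
  "\<exists>x xs. word_map u = word_map (Spin x # alternating xs) \<and> weight (Spin x # alternating xs) \<le> weight u"
proof (induction u)
  case Nil
  have "word_map [] = word_map (Spin KOne # alternating [])" by auto
  then show ?case by (metis alternating.simps(1) letter_weight.simps(2) weight_simps(1,2) add_0 le_refl)
next
  case (Cons l u)
  then obtain x xs where IH: "word_map u = word_map (Spin x # alternating xs)"
    "weight (Spin x # alternating xs) \<le> weight u" by blast
  show ?case
  proof (cases l)
    case Flip
    then have "word_map (l # u) = word_map (Spin KOne # alternating (x # xs))"
      using IH(1) by (auto simp: fun_eq_iff)
    moreover have "weight (Spin KOne # alternating (x # xs)) \<le> weight (l # u)"
      using IH(2) Flip by simp
    ultimately show ?thesis by blast
  next
    case (Spin y)
    then have "word_map (l # u) = word_map (Spin (kmul y x) # alternating xs)"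
      using IH(1) by (auto simp: fun_eq_iff act_kmul)
    moreover have "weight (Spin (kmul y x) # alternating xs) \<le> weight (l # u)"
      using IH(2) Spin letter_weight_kmul[of y x] by simp
    ultimately show ?thesis by blast
  qed
qed

text \<open>
  The summand 3 is the weight of the flip that accompanies \<open>x\<close> in an alternating word.
\<close>

lemma section_weight_Spin:
  "7 * (weight (section_word False (Spin x # u)) + weight (section_word True (Spin x # u))) \<le>
     6 * (letter_weight (Spin x) + 3) + 7 * (weight (section_word False u) + weight (section_word True u))"
  by (cases x; cases "swaps_root u") auto

text \<open>
  The contraction that drives both the torsion property and the growth estimate. It needs the
  alternation: the sections of \<open>b b b\<close> are together heavier than the word.
\<close>

lemma section_weight_alternating:
  "7 * (weight (section_word False (alternating xs)) + weight (section_word True (alternating xs)))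
     \<le> 6 * weight (alternating xs)"
proof (induction xs)
  case (Cons x xs)
  then show ?case using section_weight_Spin[of x "alternating xs"] by simp
qed simp

section \<open>Torsion and infinitude of Grigorchuk's group\<close>

definition torsion_map :: "('a \<Rightarrow> 'a) \<Rightarrow> bool" where
  "torsion_map f \<longleftrightarrow> (\<exists>n>0. f ^^ n = id)"

lemma torsion_word_of_sections:
  assumes even: "\<not> swaps_root w" and sec: "\<And>v. torsion_map (word_map (section_word v w))"
  shows "torsion_map (word_map w)"
proof -
  obtain m where m: "\<And>v. m v > 0 \<and> word_map (section_word v w) ^^ m v = id"
    using sec unfolding torsion_map_def by metis
  let ?N = "m False * m True"
  have pow: "(word_map w ^^ k) (v # t) = v # (word_map (section_word v w) ^^ k) t" for k v t
    using even by (induction k) (auto simp: word_map_Cons_arg)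
  have multiple: "word_map (section_word v w) ^^ (m v * k) = id" for v k
    using m[of v] by (simp add: funpow_mult[symmetric] id_funpow)
  have "word_map (section_word v w) ^^ ?N = id" for v
    using multiple[of v "m (\<not> v)"] by (cases v) (simp_all add: mult.commute)
  then have "(word_map w ^^ ?N) (v # t) = v # t" for v t using pow by simp
  moreover have "(word_map w ^^ k) [] = []" for k
    by (induction k) (auto simp: word_map_Nil_arg)
  ultimately have "(word_map w ^^ ?N) t = t" for t by (cases t) auto
  then show ?thesis using m unfolding torsion_map_def by (intro exI[of _ ?N]) auto
qed

lemma torsion_map_conjugate:
  assumes "torsion_map (f \<circ> g)" "g \<circ> g = id"
  shows "torsion_map (g \<circ> f)"
proof -
  obtain n where n: "n > 0" "(f \<circ> g) ^^ n = id" using assms unfolding torsion_map_def by blast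
  have *: "((g \<circ> f) ^^ k) (g t) = g (((f \<circ> g) ^^ k) t)" for k t
    by (induction k) auto
  have "((g \<circ> f) ^^ n) t = t" for t
    using *[of n "g t"] n(2) assms(2) by (simp add: fun_eq_iff)
  then show ?thesis using n(1) unfolding torsion_map_def by (intro exI[of _ n]) auto
qed

lemma torsion_map_square:
  assumes "torsion_map (f \<circ> f)"
  shows "torsion_map f"
proof -
  obtain n where n: "n > 0" "(f \<circ> f) ^^ n = id" using assms unfolding torsion_map_def by blast
  have "f ^^ (2 * n) = (f ^^ 2) ^^ n" by (simp add: funpow_mult mult.commute)
  also have "\<dots> = id" using n(2) by (simp add: numeral_2_eq_2)
  finally show ?thesis using n(1) unfolding torsion_map_def by (intro exI[of _ "2 * n"]) auto
qed

text \<open>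
  Induction on the weight. Up to conjugation the leading letter of an alternating form moves to the end and merges
  there, so a purely alternating word \<open>w\<close> remains, and both its sections are lighter. If \<open>w\<close> preserves
  the two subtrees, a common multiple of the orders of its sections kills it. If it exchanges them,
  consider \<open>w w\<close>: its section at a subtree is the product of both sections of \<open>w\<close>, and even their
  total weight is smaller than that of \<open>w\<close>.
\<close>

theorem torsion_word: "torsion_map (word_map u)"
proof (induction "weight u" arbitrary: u rule: less_induct)
  case less
  obtain x xs where nf: "word_map u = word_map (Spin x # alternating xs)"
    "weight (Spin x # alternating xs) \<le> weight u" using alternating_form by blast
  have x: "act x \<circ> act x = id" by (auto simp: act_involution)
  show ?case
  proof (cases xs rule: rev_cases)
    case Nil
    then have "word_map u \<circ> word_map u = id" using nf(1) x by simp
    then have "torsion_map (word_map u \<circ> word_map u)" unfolding torsion_map_def by (intro exI[of _ 1]) auto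
    then show ?thesis by (rule torsion_map_square)
  next
    case (snoc ys y)
    define w where "w = alternating (ys @ [kmul y x])"
    have w: "word_map w = word_map (alternating xs) \<circ> act x"
      by (auto simp: w_def snoc alternating_append word_map_append act_kmul)
    have "0 < weight w" using weight_alternating_ge[of "ys @ [kmul y x]"] by (simp add: w_def)
    moreover have wu: "weight w \<le> weight u"
      using nf(2) letter_weight_kmul[of y x] by (simp add: w_def snoc alternating_append)
    moreover have "7 * (weight (section_word False w) + weight (section_word True w)) \<le> 6 * weight w"
      unfolding w_def by (rule section_weight_alternating)
    ultimately have small: "weight (section_word False w) + weight (section_word True w) < weight u"
      by simp
    have "torsion_map (word_map w)"
    proof (cases "swaps_root w")
      case False
      have "torsion_map (word_map (section_word v w))" for v
        by (rule less) (cases v; use small in simp)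
      then show ?thesis by (rule torsion_word_of_sections[OF False])
    next
      case True
      have "torsion_map (word_map (section_word v (w @ w)))" for v
        by (rule less) (cases v; use small in \<open>simp add: section_word_append True\<close>)
      then have "torsion_map (word_map (w @ w))"
        by (rule torsion_word_of_sections[rotated]) (simp add: swaps_root_append)
      then show ?thesis unfolding word_map_append by (rule torsion_map_square)
    qed
    then have "torsion_map (act x \<circ> word_map (alternating xs))"
      unfolding w by (rule torsion_map_conjugate[OF _ x])
    then show ?thesis using nf(1) by simp
  qed
qed

text \<open>
  The words \<open>a b a\<close>, \<open>b\<close>, \<open>c\<close>, \<open>d\<close> preserve the subtrees, and act on that of \<open>True\<close> as \<open>a\<close>, \<open>c\<close>, \<open>d\<close>, \<open>b\<close>.
\<close>

lemma section_onto: "\<exists>w. \<not> swaps_root w \<and> word_map (section_word True w) = word_map u"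
proof (induction u)
  case Nil
  show ?case by (intro exI[of _ "[]"]) auto
next
  case (Cons l u)
  then obtain w where w: "\<not> swaps_root w" "word_map (section_word True w) = word_map u" by blast
  have "\<exists>z. \<not> swaps_root z \<and> word_map (section_word True z) = letter_map l"
  proof (cases l)
    case Flip
    then show ?thesis by (intro exI[of _ "[Flip, Spin KB, Flip]"]) auto
  next
    case (Spin x)
    have "shift (shift (shift x)) = x" by (cases x) auto
    then show ?thesis using Spin by (intro exI[of _ "[Spin (shift (shift x))]"]) auto
  qed
  then obtain z where "\<not> swaps_root z" "word_map (section_word True z) = letter_map l" by blast
  then show ?case using w
    by (intro exI[of _ "z @ w"]) (auto simp: swaps_root_append section_word_append word_map_append)
qed

text \<open>
  The elements preserving the two subtrees form a proper subset, which acts on the subtree of \<open>True\<close> as the whole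
  group. A finite set is not the image of a proper subset of itself.
\<close>

theorem infinite_range_word_map: "infinite (range word_map)"
proof
  assume fin: "finite (range word_map)"
  let ?St = "word_map ` {u. \<not> swaps_root u}"
  let ?s = "\<lambda>f t. tl (f (True # t))"
  have "range word_map \<subseteq> ?s ` ?St"
  proof
    fix f assume "f \<in> range word_map"
    then obtain w where w: "\<not> swaps_root w" "word_map (section_word True w) = f"
      using section_onto by blast
    then have "?s (word_map w) = f" by (auto simp: word_map_Cons_arg)
    then show "f \<in> ?s ` ?St" using w(1) by (intro image_eqI[of _ _ "word_map w"]) auto
  qed
  then have "card (range word_map) \<le> card ?St"
    by (rule surj_card_le[rotated]) (rule finite_subset[OF _ fin], blast)
  moreover have "word_map [Flip] \<notin> ?St"
  proof
    assume "word_map [Flip] \<in> ?St"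
    then obtain u where "\<not> swaps_root u" "word_map [Flip] = word_map u" by blast
    then show False using word_map_Cons_arg[of u False "[]"] word_map_Cons_arg[of "[Flip]" False "[]"] by simp
  qed
  then have "?St \<subset> range word_map" by blast
  then have "card ?St < card (range word_map)" by (rule psubset_card_mono[OF fin])
  ultimately show False by simp
qed

section \<open>Subexponential growth\<close>

definition word_ball :: "nat \<Rightarrow> (bool list \<Rightarrow> bool list) set" where
  "word_ball n = word_map ` {u. weight u \<le> n}"

lemma UNIV_klein: "(UNIV :: klein set) = {KOne, KB, KC, KD}"
  by (auto intro: klein.exhaust)

text \<open>
  An element of the ball has an alternating form with at most \<open>n\<close> flips, since each flip weighs more than 1. The
  exponential bound is the start of the iteration below.
\<close>

lemma word_ball_finite_card: "finite (word_ball n) \<and> card (word_ball n) \<le> 16 * 4 ^ n"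
proof -
  let ?L = "{xs :: klein list. set xs \<subseteq> UNIV \<and> length xs \<le> n}"
  have finL: "finite ?L" by (rule finite_lists_length_le) (simp add: UNIV_klein)
  have "card ?L = (\<Sum>i\<le>n. 4 ^ i)"
    using card_lists_length_le[of "UNIV :: klein set" n] by (simp add: UNIV_klein eval_nat_numeral)
  also have "\<dots> \<le> 4 ^ Suc n" by (induction n) auto
  finally have cL: "card ?L \<le> 4 ^ Suc n" .
  let ?P = "(UNIV :: klein set) \<times> ?L"
  let ?w = "\<lambda>(x, xs). word_map (Spin x # alternating xs)"
  have finP: "finite ?P" using finL by (simp add: UNIV_klein)
  have sub: "word_ball n \<subseteq> ?w ` ?P"
  proof
    fix f assume "f \<in> word_ball n"
    then obtain u where "f = word_map u" "weight u \<le> n" by (auto simp: word_ball_def)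
    then obtain x xs where "f = word_map (Spin x # alternating xs)" "weight (Spin x # alternating xs) \<le> n"
      using alternating_form[of u] by (metis le_trans)
    moreover from this have "length xs \<le> n" using weight_alternating_ge[of xs] by simp
    ultimately show "f \<in> ?w ` ?P" by (intro image_eqI[of _ _ "(x, xs)"]) auto
  qed
  have "card (word_ball n) \<le> card (?w ` ?P)" by (rule card_mono[OF finite_imageI[OF finP] sub])
  also have "\<dots> \<le> card ?P" by (rule card_image_le[OF finP])
  also have "\<dots> = 4 * card ?L" by (simp add: card_cartesian_product UNIV_klein)
  also have "\<dots> \<le> 16 * 4 ^ n" using cL by simp
  finally show ?thesis using finite_subset[OF sub finite_imageI[OF finP]] by blast
qed

text \<open>
  An element is determined by what it does to the two subtrees and by its action on each of them, and the
  weights of the two sections add up to at most \<open>m\<close>.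
\<close>

lemma word_ball_growth_recurrence:
  assumes "m = 6 * (n + 3) div 7"
  shows "card (word_ball n) \<le> 2 * (\<Sum>i\<le>m. card (word_ball i) * card (word_ball (m - i)))"
proof -
  \<comment> \<open>The image of the vertex \<open>[False]\<close> tells whether the two subtrees are exchanged.\<close>
  let ?s = "\<lambda>f :: bool list \<Rightarrow> bool list. (hd (f [False]), \<lambda>t. tl (f (False # t)), \<lambda>t. tl (f (True # t)))"
  let ?U = "\<Union>i\<le>m. word_ball i \<times> word_ball (m - i)"
  have s: "?s (word_map u) = (swaps_root u, word_map (section_word False u), word_map (section_word True u))" for u
    by (auto simp: word_map_Cons_arg)
  have inj: "inj_on ?s (word_ball n)"
  proof (rule inj_onI)
    fix f g assume "f \<in> word_ball n" "g \<in> word_ball n" and e: "?s f = ?s g"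
    then obtain u w where uw: "f = word_map u" "g = word_map w" by (auto simp: word_ball_def)
    then have eq: "swaps_root u = swaps_root w" "word_map (section_word v u) = word_map (section_word v w)" for v
      using e unfolding uw s by (cases v; simp)+
    have "word_map u t = word_map w t" for t
      by (cases t) (simp_all add: word_map_Nil_arg word_map_Cons_arg eq)
    then show "f = g" using uw by auto
  qed
  have sub: "?s ` word_ball n \<subseteq> UNIV \<times> ?U"
  proof
    fix p assume "p \<in> ?s ` word_ball n"
    then obtain u where u: "p = ?s (word_map u)" "weight u \<le> n" by (auto simp: word_ball_def)
    obtain x xs where nf: "word_map u = word_map (Spin x # alternating xs)"
      "weight (Spin x # alternating xs) \<le> weight u" using alternating_form by blast
    define w where "w = Spin x # alternating xs"
    have "7 * (weight (section_word False w) + weight (section_word True w)) \<le> 6 * (n + 3)"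
      using section_weight_Spin[of x "alternating xs"] section_weight_alternating[of xs] nf(2) u(2)
      unfolding w_def by simp
    then have "weight (section_word False w) + weight (section_word True w) \<le> m"
      using assms by (simp add: less_eq_div_iff_mult_less_eq)
    then have "(word_map (section_word False w), word_map (section_word True w)) \<in> ?U"
      by (intro UN_I[of "weight (section_word False w)"]) (auto simp: word_ball_def)
    then show "p \<in> UNIV \<times> ?U" unfolding u(1) nf(1) w_def[symmetric] s by simp
  qed
  have finU: "finite ?U" using word_ball_finite_card by blast
  have "card (word_ball n) = card (?s ` word_ball n)" by (rule card_image[OF inj, symmetric])
  also have "\<dots> \<le> card ((UNIV :: bool set) \<times> ?U)" using finU sub by (intro card_mono) auto
  also have "\<dots> = 2 * card ?U" by (simp add: card_cartesian_product)
  also have "card ?U \<le> (\<Sum>i\<le>m. card (word_ball i \<times> word_ball (m - i)))" by (rule card_UN_le) simp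
  finally show ?thesis by (simp add: card_cartesian_product)
qed

text \<open>
  In the recurrence each product is at most \<open>K\<^sup>2 exp (t m)\<close> with \<open>m\<close> about \<open>12/14 n\<close>. The number of summands is linear in \<open>n\<close> and is
  absorbed by enlarging \<open>12/14\<close> to \<open>13/14\<close>.
\<close>

lemma subexponential_step:
  fixes f :: "nat \<Rightarrow> real"
  assumes f: "\<And>n. 0 \<le> f n" and bd: "\<And>n. f n \<le> K * exp (t * n)" and t: "t > 0"
    and rec: "\<And>n m. m = 6 * (n + 3) div 7 \<Longrightarrow> f n \<le> 2 * (\<Sum>i\<le>m. f i * f (m - i))"
  shows "\<exists>K'. \<forall>n. f n \<le> K' * exp (13 / 14 * t * n)"
proof (intro exI allI)
  fix n :: nat
  define m where "m = 6 * (n + 3) div 7"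
  have "real (7 * m) \<le> real (6 * (n + 3))" unfolding of_nat_le_iff by (simp add: m_def)
  then have m: "real m \<le> 6 / 7 * (n + 3)" "real m + 1 \<le> real n + 4" by simp_all
  have K: "0 \<le> K" using f[of 0] bd[of 0] by simp
  have "f i * f (m - i) \<le> K\<^sup>2 * exp (t * m)" if "i \<le> m" for i
  proof -
    have "f i * f (m - i) \<le> (K * exp (t * i)) * (K * exp (t * (m - i)))"
      by (intro mult_mono bd f) (simp add: K)
    also have "\<dots> = K\<^sup>2 * exp (t * i + t * (m - i))" by (simp add: exp_add power2_eq_square)
    also have "t * i + t * (m - i) = t * m" using that by (simp add: algebra_simps of_nat_diff)
    finally show ?thesis .
  qed
  then have "(\<Sum>i\<le>m. f i * f (m - i)) \<le> (\<Sum>i\<le>m. K\<^sup>2 * exp (t * m))" by (intro sum_mono) auto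
  then have "f n \<le> 2 * ((real m + 1) * (K\<^sup>2 * exp (t * m)))" using rec[OF m_def] by (simp add: add.commute)
  also have "\<dots> \<le> 2 * (((4 + 14 / t) * exp (t * n / 14)) * (K\<^sup>2 * exp (t * (6 / 7 * (n + 3)))))"
  proof -
    have "t * n / 14 \<le> exp (t * n / 14)" using exp_ge_add_one_self[of "t * n / 14"] by linarith
    then have "14 / t * (t * n / 14) \<le> 14 / t * exp (t * n / 14)"
      using t by (intro mult_left_mono) auto
    then have "real n \<le> 14 / t * exp (t * n / 14)" using t by simp
    moreover have "1 \<le> exp (t * n / 14)" using t by simp
    ultimately have "real m + 1 \<le> 4 * exp (t * n / 14) + 14 / t * exp (t * n / 14)"
      using m(2) by linarith
    then have "real m + 1 \<le> (4 + 14 / t) * exp (t * n / 14)" by (simp only: distrib_right)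
    moreover have "exp (t * m) \<le> exp (t * (6 / 7 * (n + 3)))" using m(1) t by simp
    ultimately show ?thesis by (intro mult_left_mono mult_mono) auto
  qed
  also have "\<dots> = (2 * (4 + 14 / t) * K\<^sup>2 * exp (t * 18 / 7)) * exp (13 / 14 * t * n)"
  proof -
    have "t * n / 14 + t * (6 / 7 * (n + 3)) = t * 18 / 7 + 13 / 14 * t * n"
      by (simp add: field_simps)
    then have "exp (t * n / 14) * exp (t * (6 / 7 * (n + 3))) = exp (t * 18 / 7) * exp (13 / 14 * t * n)"
      by (metis exp_add)
    then show ?thesis by (simp add: algebra_simps)
  qed
  finally show "f n \<le> (2 * (4 + 14 / t) * K\<^sup>2 * exp (t * 18 / 7)) * exp (13 / 14 * t * n)" .
qed

lemma subexponential_growth: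
  fixes f :: "nat \<Rightarrow> real"
  assumes f: "\<And>n. 0 \<le> f n" and bd: "\<And>n. f n \<le> K * exp (t * n)" and t: "t > 0"
    and rec: "\<And>n m. m = 6 * (n + 3) div 7 \<Longrightarrow> f n \<le> 2 * (\<Sum>i\<le>m. f i * f (m - i))"
    and s: "s > 0"
  shows "\<exists>K. \<forall>n. f n \<le> K * exp (s * n)"
proof -
  have iter: "\<exists>K. \<forall>n. f n \<le> K * exp ((13 / 14) ^ k * t * n)" for k
  proof (induction k)
    case 0
    then show ?case using bd by auto
  next
    case (Suc k)
    then obtain K where "\<And>n. f n \<le> K * exp ((13 / 14) ^ k * t * n)" by blast
    from subexponential_step[OF f this _ rec] t show ?case by (simp add: mult.assoc)
  qed
  obtain k where "(13 / 14 :: real) ^ k < s / t"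
    using real_arch_pow_inv[of "s / t" "13 / 14"] s t by auto
  then have k: "(13 / 14 :: real) ^ k * t \<le> s" using t by (simp add: field_simps)
  obtain K where K: "\<And>n. f n \<le> K * exp ((13 / 14) ^ k * t * n)" using iter by blast
  have "0 \<le> K" using f[of 0] K[of 0] by simp
  then have "K * exp ((13 / 14) ^ k * t * n) \<le> K * exp (s * n)" for n :: nat
    using k by (intro mult_left_mono) (simp_all add: mult_right_mono)
  then show ?thesis using K order_trans by blast
qed

text \<open>
  If every step of length 4 multiplied \<open>f\<close> by more than \<open>1 + e\<close>, then \<open>f\<close> would grow exponentially. The length 4 is the largest weight of a
  letter.
\<close>

lemma subexponential_slow_step:
  fixes f :: "nat \<Rightarrow> real"
  assumes f0: "1 \<le> f 0" and sub: "\<And>s. s > 0 \<Longrightarrow> \<exists>K. \<forall>n. f n \<le> K * exp (s * n)"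
    and e: "e > 0"
  shows "\<exists>n. f (n + 4) \<le> (1 + e) * f n"
proof (rule ccontr)
  assume "\<not> ?thesis"
  then have fast: "(1 + e) * f n < f (n + 4)" for n by (auto simp: not_le)
  define c where "c = ln (1 + e)"
  have c: "c > 0" "exp c = 1 + e" using e by (auto simp: c_def)
  \<comment> \<open>The rate \<open>c / 8\<close> gives \<open>exp (c k / 2)\<close> at \<open>4 k\<close>, against the supposed growth \<open>exp (c k)\<close>.\<close>
  obtain K where K: "\<And>n. f n \<le> K * exp (c / 8 * n)" using sub[of "c / 8"] c by auto
  have "exp (c * k) \<le> f (4 * k)" for k :: nat
  proof (induction k)
    case (Suc k)
    have "exp (c * Suc k) = (1 + e) * exp (c * k)" using c(2) by (simp add: algebra_simps exp_add)
    also have "\<dots> \<le> (1 + e) * f (4 * k)" using Suc e by (intro mult_left_mono) auto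
    also have "\<dots> \<le> f (4 * Suc k)" using fast[of "4 * k"] by (simp add: add.commute)
    finally show ?case .
  qed (use f0 in simp)
  then have "exp (c * k) \<le> K * exp (c / 2 * k)" for k :: nat
    using K[of "4 * k"] order_trans by fastforce
  then have "exp (c / 2 * k) * exp (c / 2 * k) \<le> K * exp (c / 2 * k)" for k :: nat
    by (metis exp_add field_sum_of_halves distrib_right)
  then have "exp (c / 2 * k) \<le> K" for k :: nat by simp
  then have "c / 2 * k \<le> K" for k :: nat
    using exp_ge_add_one_self[of "c / 2 * k"] by (smt (verit))
  moreover obtain k :: nat where "K < real k * (c / 2)" using c(1) reals_Archimedean3[of "c / 2"] by auto
  ultimately show False by (metis mult.commute not_le)
qed

lemma word_ball_slow_step:
  assumes "e > 0"
  shows "\<exists>n. real (card (word_ball (n + 4))) \<le> (1 + e) * real (card (word_ball n))"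
proof (rule subexponential_slow_step[where f = "\<lambda>n. real (card (word_ball n))"])
  have "id \<in> word_ball 0" unfolding word_ball_def by (intro image_eqI[of _ _ "[]"]) auto
  then show "1 \<le> real (card (word_ball 0))"
    using word_ball_finite_card[of 0] by (metis card_gt_0_iff empty_iff of_nat_1 of_nat_le_iff Suc_leI One_nat_def)
  fix s :: real assume s: "s > 0"
  show "\<exists>K. \<forall>n. real (card (word_ball n)) \<le> K * exp (s * n)"
  proof (rule subexponential_growth[where t = "ln 4" and K = 16, OF _ _ _ _ s])
    show "real (card (word_ball n)) \<le> 16 * exp (ln 4 * n)" for n
    proof -
      have "exp (ln 4 * real n) = 4 ^ n" by (simp add: exp_of_nat2_mult)
      moreover have "real (card (word_ball n)) \<le> real (16 * 4 ^ n)"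
        using word_ball_finite_card[of n] of_nat_le_iff by blast
      ultimately show ?thesis by simp
    qed
    fix n m :: nat assume "m = 6 * (n + 3) div 7"
    from word_ball_growth_recurrence[OF this]
    have "real (card (word_ball n)) \<le> real (2 * (\<Sum>i\<le>m. card (word_ball i) * card (word_ball (m - i))))"
      by (simp only: of_nat_le_iff)
    then show "real (card (word_ball n)) \<le> 2 * (\<Sum>i\<le>m. real (card (word_ball i)) * real (card (word_ball (m - i))))"
      by simp
  qed auto
qed (rule assms)

section \<open>Amenability from almost invariant finite sets\<close>

text \<open>
  By Tychonoff's theorem the functions with values in the unit interval form a compact space, so the sequence
  \<open>m\<close> has a cluster point \<open>\<mu>\<close>. The filter \<open>F\<close> restricts the tails of the indices to those \<open>k\<close> for which \<open>m k\<close> is near \<open>\<mu>\<close>; limits along it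
  take the part that ultrafilter limits have elsewhere.
\<close>

lemma coordinatewise_limit_along_filter:
  fixes m :: "nat \<Rightarrow> 'b \<Rightarrow> real"
  assumes "\<And>k A. m k A \<in> {0..1}"
  shows "\<exists>\<mu> F. F \<noteq> bot \<and> F \<le> sequentially \<and> (\<forall>A. ((\<lambda>k. m k A) \<longlongrightarrow> \<mu> A) F)"
proof -
  let ?C = "PiE UNIV (\<lambda>_::'b. {0..1::real})"
  have "compactin (product_topology (\<lambda>_. euclidean) UNIV) ?C"
    by (subst compactin_PiE) auto
  then have C: "compact ?C" unfolding euclidean_product_topology by simp
  have "\<forall>\<^sub>F x in filtermap m sequentially. x \<in> ?C"
    using assms by (simp add: eventually_filtermap PiE_iff)
  moreover have "filtermap m sequentially \<noteq> bot" by (simp add: filtermap_bot_iff)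
  ultimately obtain \<mu> where \<mu>: "inf (nhds \<mu>) (filtermap m sequentially) \<noteq> bot"
    using C unfolding compact_filter by blast
  define F where "F = inf sequentially (filtercomap m (nhds \<mu>))"
  have "F \<noteq> bot"
  proof
    assume "F = bot"
    then have "\<forall>\<^sub>F x in F. False" by simp
    then obtain P Q where P: "\<forall>\<^sub>F k in sequentially. P k" and Q: "\<forall>\<^sub>F x in nhds \<mu>. Q x"
      and PQ: "\<And>k. P k \<Longrightarrow> Q (m k) \<Longrightarrow> False"
      unfolding F_def eventually_inf eventually_filtercomap by blast
    have "\<forall>\<^sub>F x in filtermap m sequentially. \<not> Q x"
      unfolding eventually_filtermap using PQ by (intro eventually_mono[OF P]) blast
    then have "\<forall>\<^sub>F x in inf (nhds \<mu>) (filtermap m sequentially). False"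
      using Q unfolding eventually_inf by blast
    then show False using \<mu> by (simp add: eventually_False)
  qed
  moreover have "F \<le> sequentially" by (simp add: F_def)
  moreover have "((\<lambda>k. m k A) \<longlongrightarrow> \<mu> A) F" for A
  proof -
    have "(m \<longlongrightarrow> \<mu>) F" unfolding filterlim_iff_le_filtercomap F_def by simp
    then show ?thesis
      using continuous_on_tendsto_compose[OF continuous_on_product_coordinates[of A], of m \<mu> F] by simp
  qed
  ultimately show ?thesis by blast
qed

text \<open>
  Translation by \<open>g\<close> maps \<open>A \<inter> F\<close> into the translate of \<open>A\<close>, and takes only few of its elements out of \<open>F\<close> if \<open>F\<close> is
  almost invariant.
\<close>

lemma (in group) card_l_coset_inter_ge:
  assumes g: "g \<in> carrier G" and A: "A \<subseteq> carrier G" and F: "finite F" "F \<subseteq> carrier G"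
  shows "card (A \<inter> F) \<le> card ((g <#\<^bsub>G\<^esub> A) \<inter> F) + card ((g <#\<^bsub>G\<^esub> F) - F)"
proof -
  have inj: "inj_on ((\<otimes>) g) (carrier G)" using g by (auto simp: inj_on_def)
  have coset: "g <#\<^bsub>G\<^esub> B = (\<otimes>) g ` B" for B by (auto simp: l_coset_def)
  have "card (A \<inter> F) = card ((\<otimes>) g ` (A \<inter> F))"
    by (rule card_image[symmetric]) (use inj_on_subset[OF inj] F in blast)
  also have "\<dots> \<le> card (((g <#\<^bsub>G\<^esub> A) \<inter> F) \<union> ((g <#\<^bsub>G\<^esub> F) - F))"
    unfolding coset using F by (intro card_mono) auto
  also have "\<dots> \<le> card ((g <#\<^bsub>G\<^esub> A) \<inter> F) + card ((g <#\<^bsub>G\<^esub> F) - F)" by (rule card_Un_le)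
  finally show ?thesis .
qed

text \<open>
  The invariant measure is a limit of the normalized counting measures of almost invariant finite sets. In the
  limit, \<open>\<mu> A \<le> \<mu> (s A)\<close> for a generator \<open>s\<close>; the same for the complement of \<open>A\<close> gives equality. The elements
  that preserve \<open>\<mu>\<close> are closed under products and inverses, so generators suffice.
\<close>

lemma (in group) Folner_imp_amenable:
  assumes S: "S \<subseteq> carrier G" "generate G S = carrier G"
    and Folner: "\<And>e::real. e > 0 \<Longrightarrow> \<exists>F. finite F \<and> F \<noteq> {} \<and> F \<subseteq> carrier G \<and>
       (\<forall>s\<in>S. card ((s <#\<^bsub>G\<^esub> F) - F) \<le> e * card F)"
  shows "amenable_group G"
proof -
  have "\<exists>F. finite F \<and> F \<noteq> {} \<and> F \<subseteq> carrier G \<and>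
       (\<forall>s\<in>S. card ((s <#\<^bsub>G\<^esub> F) - F) \<le> inverse (real (Suc k)) * card F)" for k
    by (rule Folner) simp
  then obtain F where F: "\<And>k. finite (F k)" "\<And>k. F k \<noteq> {}" "\<And>k. F k \<subseteq> carrier G"
    "\<And>k s. s \<in> S \<Longrightarrow> card ((s <#\<^bsub>G\<^esub> F k) - F k) \<le> inverse (real (Suc k)) * card (F k)"
    by metis
  define m where "m k A = real (card (A \<inter> F k)) / card (F k)" for k A
  have pos: "real (card (F k)) > 0" for k using F(1,2) by (simp add: card_gt_0_iff)
  have "m k A \<in> {0..1}" for k A
    using pos[of k] card_mono[OF F(1)[of k], of "A \<inter> F k"] by (simp add: m_def)
  then obtain \<mu> U where U: "U \<noteq> bot" "U \<le> sequentially" and lim: "\<And>A. ((\<lambda>k. m k A) \<longlongrightarrow> \<mu> A) U"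
    using coordinatewise_limit_along_filter[of m] by blast
  have nonneg: "0 \<le> \<mu> A" for A
    by (rule tendsto_lowerbound[OF lim[of A] _ U(1)]) (simp add: m_def)
  have one: "\<mu> (carrier G) = 1"
  proof (rule tendsto_unique[OF U(1) lim])
    have "m k (carrier G) = 1" for k using pos[of k] F(3)[of k] by (simp add: m_def Int_absorb1)
    then show "((\<lambda>k. m k (carrier G)) \<longlongrightarrow> 1) U" by simp
  qed
  have add: "\<mu> (A \<union> B) = \<mu> A + \<mu> B" if "A \<inter> B = {}" for A B
  proof (rule tendsto_unique[OF U(1) lim])
    have "m k (A \<union> B) = m k A + m k B" for k
      using that F(1)[of k] unfolding m_def Int_Un_distrib2
      by (subst card_Un_disjoint) (auto simp: add_divide_distrib)
    then show "((\<lambda>k. m k (A \<union> B)) \<longlongrightarrow> \<mu> A + \<mu> B) U"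
      using tendsto_add[OF lim[of A] lim[of B]] by simp
  qed
  have le: "\<mu> A \<le> \<mu> (s <#\<^bsub>G\<^esub> A)" if s: "s \<in> S" and A: "A \<subseteq> carrier G" for s A
  proof (rule tendsto_le[OF U(1) _ lim[of A]])
    have "m k A \<le> m k (s <#\<^bsub>G\<^esub> A) + inverse (real (Suc k))" for k
    proof -
      have "real (card (A \<inter> F k)) \<le> card ((s <#\<^bsub>G\<^esub> A) \<inter> F k) + card ((s <#\<^bsub>G\<^esub> F k) - F k)"
        using card_l_coset_inter_ge[of s A "F k"] s S(1) A F(1,3) by (simp add: subset_iff del: of_nat_add flip: of_nat_add)
      also have "\<dots> \<le> card ((s <#\<^bsub>G\<^esub> A) \<inter> F k) + inverse (real (Suc k)) * card (F k)"
        using F(4)[OF s, of k] by simp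
      finally show ?thesis
        using divide_right_mono[of _ _ "real (card (F k))"] pos[of k] by (fastforce simp: m_def add_divide_distrib)
    qed
    then show "\<forall>\<^sub>F k in U. m k A \<le> m k (s <#\<^bsub>G\<^esub> A) + inverse (real (Suc k))" by simp
    have "((\<lambda>k. inverse (real (Suc k))) \<longlongrightarrow> 0) U"
      by (rule tendsto_mono[OF U(2) LIMSEQ_inverse_real_of_nat])
    from tendsto_add[OF lim this]
    show "((\<lambda>k. m k (s <#\<^bsub>G\<^esub> A) + inverse (real (Suc k))) \<longlongrightarrow> \<mu> (s <#\<^bsub>G\<^esub> A)) U" by simp
  qed
  have inv_S: "\<mu> (s <#\<^bsub>G\<^esub> A) = \<mu> A" if s: "s \<in> S" and A: "A \<subseteq> carrier G" for s A
  proof -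
    have sG: "s \<in> carrier G" using s S by blast
    have compl: "\<mu> B + \<mu> (carrier G - B) = 1" if "B \<subseteq> carrier G" for B
      using add[of B "carrier G - B"] one that by (simp add: Un_absorb1)
    have "s <#\<^bsub>G\<^esub> (carrier G - A) = carrier G - (s <#\<^bsub>G\<^esub> A)"
    proof
      show "s <#\<^bsub>G\<^esub> (carrier G - A) \<subseteq> carrier G - (s <#\<^bsub>G\<^esub> A)"
        using sG subsetD[OF A] by (auto simp: l_coset_def)
      show "carrier G - (s <#\<^bsub>G\<^esub> A) \<subseteq> s <#\<^bsub>G\<^esub> (carrier G - A)"
      proof
        fix x assume x: "x \<in> carrier G - (s <#\<^bsub>G\<^esub> A)"
        then have e: "x = s \<otimes> (inv s \<otimes> x)" using sG by (simp add: m_assoc[symmetric])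
        then have "inv s \<otimes> x \<notin> A" using x by (auto simp: l_coset_def)
        then show "x \<in> s <#\<^bsub>G\<^esub> (carrier G - A)" using e x sG by (auto simp: l_coset_def)
      qed
    qed
    then have "\<mu> (carrier G - A) \<le> \<mu> (carrier G - (s <#\<^bsub>G\<^esub> A))" using le[OF s, of "carrier G - A"] by simp
    moreover have "s <#\<^bsub>G\<^esub> A \<subseteq> carrier G" using l_coset_subset_G[OF A sG] .
    ultimately show ?thesis using le[OF s A] compl[OF A] compl[of "s <#\<^bsub>G\<^esub> A"] by simp
  qed
  have "\<forall>A \<subseteq> carrier G. \<mu> (g <#\<^bsub>G\<^esub> A) = \<mu> A" if "g \<in> generate G S" for g
    using that
  proof (induction rule: generate.induct)
    case one
    then show ?case by (auto simp: l_coset_def subset_iff intro!: arg_cong[of _ _ \<mu>])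
  next
    case (incl h)
    then show ?case using inv_S by blast
  next
    case (inv h)
    show ?case
    proof (intro allI impI)
      fix A assume A: "A \<subseteq> carrier G"
      have h: "h \<in> carrier G" using inv S by blast
      have "\<mu> (h <#\<^bsub>G\<^esub> (inv h <#\<^bsub>G\<^esub> A)) = \<mu> (inv h <#\<^bsub>G\<^esub> A)"
        using inv_S[OF inv] l_coset_subset_G[OF A] h by simp
      moreover have "h <#\<^bsub>G\<^esub> (inv h <#\<^bsub>G\<^esub> A) = A" using A h by (simp add: lcos_m_assoc lcos_mult_one)
      ultimately show "\<mu> (inv h <#\<^bsub>G\<^esub> A) = \<mu> A" by simp
    qed
  next
    case (eng h1 h2)
    then have "h1 \<in> carrier G" "h2 \<in> carrier G" using S by auto
    then show ?case using eng.IH l_coset_subset_G by (simp add: lcos_m_assoc[symmetric])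
  qed
  then show ?thesis
    unfolding amenable_group_def using group_axioms nonneg one add S(2) by (intro conjI exI[of _ \<mu>]) auto
qed

section \<open>Isomorphic copies\<close>

lemma iso_finitely_generated:
  assumes "finitely_generated_group G" "group H" "\<phi> \<in> iso G H"
  shows "finitely_generated_group H"
proof -
  obtain S where S: "finite S" "S \<subseteq> carrier G" "generate G S = carrier G" and G: "group G"
    using assms(1) by (auto simp: finitely_generated_group_def)
  interpret group_hom G H \<phi>
    using assms G by (simp add: group_hom_def group_hom_axioms_def iso_def)
  have "generate H (\<phi> ` S) = carrier H"
    using generate_img[OF S(2)] S(3) assms(3) by (simp add: iso_def bij_betw_def)
  moreover have "\<phi> ` S \<subseteq> carrier H" using S(2) by auto
  ultimately show ?thesis
    unfolding finitely_generated_group_def using S(1) assms(2) by blast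
qed

text \<open>
  The measure is transported by taking preimages.
\<close>

lemma iso_amenable:
  assumes "amenable_group G" "group H" "\<phi> \<in> iso G H"
  shows "amenable_group H"
proof -
  have G: "group G" using assms(1) by (simp add: amenable_group_def)
  obtain \<mu> :: "_ set \<Rightarrow> real" where \<mu>: "\<And>A. A \<subseteq> carrier G \<Longrightarrow> 0 \<le> \<mu> A"
    "\<mu> (carrier G) = 1"
    "\<And>A B. A \<subseteq> carrier G \<Longrightarrow> B \<subseteq> carrier G \<Longrightarrow> A \<inter> B = {} \<Longrightarrow> \<mu> (A \<union> B) = \<mu> A + \<mu> B"
    "\<And>g A. g \<in> carrier G \<Longrightarrow> A \<subseteq> carrier G \<Longrightarrow> \<mu> (g <#\<^bsub>G\<^esub> A) = \<mu> A"
    using assms(1) unfolding amenable_group_def by iprover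
  interpret group_hom G H \<phi>
    using assms G by (simp add: group_hom_def group_hom_axioms_def iso_def)
  have bij: "inj_on \<phi> (carrier G)" "\<phi> ` carrier G = carrier H"
    using assms(3) by (auto simp: iso_def bij_betw_def)
  define pre where "pre A = {x \<in> carrier G. \<phi> x \<in> A}" for A
  have pre: "pre A \<subseteq> carrier G" for A by (auto simp: pre_def)
  have coset: "pre (h <#\<^bsub>H\<^esub> A) = g <#\<^bsub>G\<^esub> pre A"
    if g: "g \<in> carrier G" "h = \<phi> g" and A: "A \<subseteq> carrier H" for g h A
  proof
    show "g <#\<^bsub>G\<^esub> pre A \<subseteq> pre (h <#\<^bsub>H\<^esub> A)"
      using g by (auto simp: pre_def l_coset_def)
    show "pre (h <#\<^bsub>H\<^esub> A) \<subseteq> g <#\<^bsub>G\<^esub> pre A"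
    proof
      fix x assume "x \<in> pre (h <#\<^bsub>H\<^esub> A)"
      then obtain a where a: "x \<in> carrier G" "a \<in> A" "\<phi> x = h \<otimes>\<^bsub>H\<^esub> a" by (auto simp: pre_def l_coset_def)
      then obtain y where y: "y \<in> carrier G" "a = \<phi> y" using A bij(2) by blast
      then have "\<phi> x = \<phi> (g \<otimes>\<^bsub>G\<^esub> y)" using a g by simp
      then have "x = g \<otimes>\<^bsub>G\<^esub> y" using inj_onD[OF bij(1)] a y g by simp
      then show "x \<in> g <#\<^bsub>G\<^esub> pre A" using a y by (auto simp: pre_def l_coset_def)
    qed
  qed
  have "\<mu> (pre (A \<union> B)) = \<mu> (pre A) + \<mu> (pre B)" if "A \<inter> B = {}" for A B
  proof -
    have "pre (A \<union> B) = pre A \<union> pre B" "pre A \<inter> pre B = {}" using that by (auto simp: pre_def)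
    then show ?thesis using \<mu>(3)[OF pre pre, of A B] by simp
  qed
  moreover have "pre (carrier H) = carrier G" by (auto simp: pre_def)
  moreover have "\<mu> (pre (h <#\<^bsub>H\<^esub> A)) = \<mu> (pre A)" if h: "h \<in> carrier H" and A: "A \<subseteq> carrier H" for h A
  proof -
    obtain g where g: "g \<in> carrier G" "h = \<phi> g" using h bij(2) by blast
    show ?thesis unfolding coset[OF g A] by (rule \<mu>(4)[OF g(1) pre])
  qed
  ultimately show ?thesis
    unfolding amenable_group_def using assms(2) \<mu>(1)[OF pre] \<mu>(2) by (intro conjI exI[of _ "\<mu> \<circ> pre"]) auto
qed

lemma countable_group_iso_nat:
  assumes "group G" "countable (carrier G)"
  shows "\<exists>H :: nat monoid. group H \<and> G \<cong> H"
proof -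
  interpret group G by fact
  let ?e = "to_nat_on (carrier G)" and ?d = "from_nat_into (carrier G)"
  define H where "H = \<lparr>carrier = ?e ` carrier G, monoid.mult = \<lambda>x y. ?e (?d x \<otimes>\<^bsub>G\<^esub> ?d y), one = ?e \<one>\<^bsub>G\<^esub>\<rparr>"
  have d: "?d (?e x) = x" if "x \<in> carrier G" for x using that assms(2) by simp
  have "group H"
  proof (rule groupI)
    fix x assume "x \<in> carrier H"
    then obtain a where "a \<in> carrier G" "x = ?e a" by (auto simp: H_def)
    then show "\<exists>y\<in>carrier H. y \<otimes>\<^bsub>H\<^esub> x = \<one>\<^bsub>H\<^esub>"
      by (intro bexI[of _ "?e (inv\<^bsub>G\<^esub> a)"]) (auto simp: H_def d)
  qed (auto simp: H_def d m_assoc)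
  moreover have "?e \<in> iso G H"
    using assms(2) by (auto simp: iso_def hom_def bij_betw_def H_def d inj_on_to_nat_on)
  ultimately show ?thesis unfolding is_iso_def by blast
qed

section \<open>Grigorchuk's group\<close>

definition Grigorchuk_group :: "(bool list \<Rightarrow> bool list) monoid" where
  "Grigorchuk_group = \<lparr>carrier = range word_map, monoid.mult = (\<circ>), one = id\<rparr>"

interpretation Grigorchuk: group Grigorchuk_group
proof (rule groupI)
  fix f g assume "f \<in> carrier Grigorchuk_group" "g \<in> carrier Grigorchuk_group"
  then obtain u w where "f = word_map u" "g = word_map w" by (auto simp: Grigorchuk_group_def)
  then have "f \<circ> g = word_map (u @ w)" by (simp add: word_map_append)
  then show "f \<otimes>\<^bsub>Grigorchuk_group\<^esub> g \<in> carrier Grigorchuk_group" by (simp add: Grigorchuk_group_def)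
next
  have "id = word_map []" by simp
  then show "\<one>\<^bsub>Grigorchuk_group\<^esub> \<in> carrier Grigorchuk_group"
    unfolding Grigorchuk_group_def by (simp del: word_map.simps)
next
  fix f assume "f \<in> carrier Grigorchuk_group"
  then obtain u where "f = word_map u" by (auto simp: Grigorchuk_group_def)
  then show "\<exists>g\<in>carrier Grigorchuk_group. g \<otimes>\<^bsub>Grigorchuk_group\<^esub> f = \<one>\<^bsub>Grigorchuk_group\<^esub>"
    by (intro bexI[of _ "word_map (rev u)"]) (auto simp: Grigorchuk_group_def word_map_rev)
qed (auto simp: Grigorchuk_group_def)

definition Grigorchuk_generators :: "(bool list \<Rightarrow> bool list) set" where
  "Grigorchuk_generators = range letter_map"

lemma UNIV_letter: "(UNIV :: letter set) = insert Flip (range Spin)"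
proof -
  have "l = Flip \<or> l \<in> range Spin" for l by (cases l) auto
  then show ?thesis by blast
qed

lemma Grigorchuk_generators: "finite Grigorchuk_generators"
  "Grigorchuk_generators \<subseteq> carrier Grigorchuk_group"
  "generate Grigorchuk_group Grigorchuk_generators = carrier Grigorchuk_group"
proof -
  have "finite (UNIV :: letter set)" by (simp add: UNIV_letter UNIV_klein)
  then show "finite Grigorchuk_generators" by (simp add: Grigorchuk_generators_def)
  have "letter_map l = word_map [l]" for l by simp
  then show S: "Grigorchuk_generators \<subseteq> carrier Grigorchuk_group"
    unfolding Grigorchuk_generators_def Grigorchuk_group_def by (metis image_subsetI monoid.select_convs(1) partial_object.select_convs(1) rangeI)
  have "word_map u \<in> generate Grigorchuk_group Grigorchuk_generators" for u
  proof (induction u)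
    case Nil
    have "word_map [] = \<one>\<^bsub>Grigorchuk_group\<^esub>" by (simp add: Grigorchuk_group_def)
    then show ?case by (metis generate.one)
  next
    case (Cons l u)
    have "letter_map l \<in> generate Grigorchuk_group Grigorchuk_generators"
      by (rule generate.incl) (simp add: Grigorchuk_generators_def)
    moreover have "letter_map l \<otimes>\<^bsub>Grigorchuk_group\<^esub> word_map u = word_map (l # u)"
      by (simp add: Grigorchuk_group_def)
    ultimately show ?case using Cons by (metis generate.eng)
  qed
  then show "generate Grigorchuk_group Grigorchuk_generators = carrier Grigorchuk_group"
    using Grigorchuk.generate_incl[OF S] by (auto simp: Grigorchuk_group_def)
qed

lemma Grigorchuk_torsion:
  assumes "f \<in> carrier Grigorchuk_group"
  shows "\<exists>n::nat>0. f [^]\<^bsub>Grigorchuk_group\<^esub> n = \<one>\<^bsub>Grigorchuk_group\<^esub>"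
proof -
  have pow: "f [^]\<^bsub>Grigorchuk_group\<^esub> n = f ^^ n" for n :: nat
  proof (induction n)
    case (Suc n)
    then show ?case by (simp add: Grigorchuk_group_def funpow_Suc_right del: funpow.simps)
  qed (simp add: Grigorchuk_group_def)
  have "torsion_map f" using assms torsion_word by (auto simp: Grigorchuk_group_def)
  then show ?thesis unfolding torsion_map_def pow by (simp add: Grigorchuk_group_def)
qed

text \<open>
  A generator \<open>s\<close> has weight at most 4, so \<open>s\<close> moves the ball of radius \<open>n\<close> into the one of radius \<open>n + 4\<close>. For
  suitable \<open>n\<close> the larger ball is hardly larger, so the smaller one is almost invariant.
\<close>

lemma Grigorchuk_amenable: "amenable_group Grigorchuk_group"
proof (rule Grigorchuk.Folner_imp_amenable[OF Grigorchuk_generators(2,3)])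
  fix e :: real assume "e > 0"
  then obtain n where n: "real (card (word_ball (n + 4))) \<le> (1 + e) * real (card (word_ball n))"
    using word_ball_slow_step by blast
  have fin: "finite (word_ball k)" for k using word_ball_finite_card by blast
  have mono: "word_ball n \<subseteq> word_ball (n + 4)" by (auto simp: word_ball_def)
  have "real (card ((s <#\<^bsub>Grigorchuk_group\<^esub> word_ball n) - word_ball n)) \<le> e * real (card (word_ball n))"
    if s: "s \<in> Grigorchuk_generators" for s
  proof -
    obtain l where l: "s = letter_map l" using s by (auto simp: Grigorchuk_generators_def)
    have lw: "letter_weight l \<le> 4" by (cases l rule: letter_weight.cases) auto
    have "s <#\<^bsub>Grigorchuk_group\<^esub> word_ball n \<subseteq> word_ball (n + 4)"
    proof
      fix f assume "f \<in> s <#\<^bsub>Grigorchuk_group\<^esub> word_ball n"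
      then obtain u where u: "f = s \<circ> word_map u" "weight u \<le> n"
        by (auto simp: l_coset_def word_ball_def Grigorchuk_group_def)
      then have "f = word_map (l # u)" "weight (l # u) \<le> n + 4" using l lw by auto
      then show "f \<in> word_ball (n + 4)" unfolding word_ball_def by blast
    qed
    then have "card ((s <#\<^bsub>Grigorchuk_group\<^esub> word_ball n) - word_ball n) \<le> card (word_ball (n + 4) - word_ball n)"
      using fin by (intro card_mono) auto
    also have "\<dots> = card (word_ball (n + 4)) - card (word_ball n)"
      by (rule card_Diff_subset[OF fin mono])
    finally have "real (card ((s <#\<^bsub>Grigorchuk_group\<^esub> word_ball n) - word_ball n)) \<le> real (card (word_ball (n + 4))) - card (word_ball n)"
      using card_mono[OF fin mono] by linarith
    then show ?thesis using n by (simp add: distrib_right)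
  qed
  moreover have "word_ball n \<noteq> {}" unfolding word_ball_def by (auto intro: exI[of _ "[]"])
  moreover have "word_ball n \<subseteq> carrier Grigorchuk_group" by (auto simp: word_ball_def Grigorchuk_group_def)
  ultimately show "\<exists>F. finite F \<and> F \<noteq> {} \<and> F \<subseteq> carrier Grigorchuk_group \<and>
      (\<forall>s\<in>Grigorchuk_generators. real (card ((s <#\<^bsub>Grigorchuk_group\<^esub> F) - F)) \<le> e * real (card F))"
    using fin by blast
qed

text \<open>
  Elementary amenability is invariant under isomorphism, so it may be refuted for the group of tree
  permutations instead of its copy on the natural numbers.
\<close>

theorem corollary1p4:
  "\<exists>G :: nat monoid. finitely_generated_group G \<and> amenable_group G \<and>
     \<not> elementary_amenable_group G"
proof -
  have "countable (UNIV :: letter set)"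
    by (simp add: UNIV_letter UNIV_klein)
  then have "countable (UNIV :: letter list set)"
    by (metis countable_lists lists_UNIV)
  then have "countable (carrier Grigorchuk_group)"
    unfolding Grigorchuk_group_def by simp
  then obtain H :: "nat monoid" where H: "group H" "Grigorchuk_group \<cong> H"
    using countable_group_iso_nat[OF Grigorchuk.group_axioms] by blast
  then obtain \<phi> where \<phi>: "\<phi> \<in> iso Grigorchuk_group H" by (auto simp: is_iso_def)
  have fg: "finitely_generated_group Grigorchuk_group"
    unfolding finitely_generated_group_def using Grigorchuk_generators Grigorchuk.group_axioms by blast
  have "\<not> elementary_amenable_group Grigorchuk_group"
    using elementary_amenable_torsion_finite[OF _ fg Grigorchuk_torsion] infinite_range_word_map
    by (auto simp: Grigorchuk_group_def)
  moreover have "elementary_amenable_group Grigorchuk_group" if "elementary_amenable_group H"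
    using that H(2) Grigorchuk.group_axioms unfolding elementary_amenable_group_nat_iff
    unfolding elementary_amenable_group_def by blast
  ultimately have "\<not> elementary_amenable_group H" by blast
  moreover have "finitely_generated_group H" by (rule iso_finitely_generated[OF fg H(1) \<phi>])
  moreover have "amenable_group H" by (rule iso_amenable[OF Grigorchuk_amenable H(1) \<phi>])
  ultimately show ?thesis by blast
qed

end
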